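(* Let $(M,P,g)$ be a Riemannian almost product manifold with $\mathrm{tr}\,P=0$, $\dim M=2n\ge 6$, belonging to the class $\overline{\mathcal W}_3\cup\overline{\mathcal W}_6$, and suppose that its associated 1-form $\theta$ is closed. If $R'$ is the curvature tensor of type $(0,4)$ of a natural connection $\nabla'$ on $(M,P,g)$, then $B(R')=B(K)$.
   Context: A Riemannian almost product manifold $(M,P,g)$ is a differentiable manifold $M$ with a Riemannian metric $g$ and a $(1,1)$-tensor field $P$ such that $P^2x=x$ and $g(Px,Py)=g(x,y)$; here $\mathrm{tr}\,P=0$ and $\dim M=2n$. $x,y,z,w$ denote arbitrary vector fields (or tangent vectors at a point). $\nabla$ is the Levi-Civita connection of $g$, $F(x,y,z)=g((\nabla_xP)y,z)$, and the associated 1-form is $\theta(x)=g^{ij}F(e_i,e_j,x)$ for a local basis $\{e_i\}$. Class $\overline{\mathcal W}_3$: $F(x,y,z)=\frac1{2n}\{[g(x,y)+g(x,Py)]\theta(z)+[g(x,z)+g(x,Pz)]\theta(y)\}$ and $\theta(Px)=-\theta(x)$. Class $\overline{\mathcal W}_6$: $F(x,y,z)=\frac1{2n}\{[g(x,y)-g(x,Py)]\theta(z)+[g(x,z)-g(x,Pz)]\theta(y)\}$ and $\theta(Px)=\theta(x)$. $(M,P,g)\in\overline{\mathcal W}_3\cup\overline{\mathcal W}_6$ means that $(M,P,g)$ belongs to one of these two classes. A natural connection is a linear connection $\nabla'$ with $\nabla'P=\nabla'g=0$; on these manifolds the natural connections considered are those of the 2-parameter family ($\lambda,\mu\in\mathbb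 R$) whose torsion $T(x,y,z)=g(T(x,y),z)$ is $$T(x,y,z)=\tfrac1{2n}\{g(y,z)\theta(Px)-g(x,z)\theta(Py)\}+\lambda\{g(y,z)\theta(x)-g(x,z)\theta(y)+g(y,Pz)\theta(Px)-g(x,Pz)\theta(Py)\}+\mu\{g(y,Pz)\theta(x)-g(x,Pz)\theta(y)+g(y,z)\theta(Px)-g(x,z)\theta(Py)\}.$$ Curvature: $R(x,y)z=\nabla_x\nabla_yz-\nabla_y\nabla_xz-\nabla_{[x,y]}z$, $R(x,y,z,w)=g(R(x,y)z,w)$, and $R'$ is defined in the same way from $\nabla'$. The tensor $K$ is $K(x,y,z,w)=\frac12[R(x,y,z,w)+R(x,y,Pz,Pw)]$. A curvature-like tensor is a $(0,4)$-tensor $L$ with $L(x,y,z,w)=-L(y,x,z,w)=-L(x,y,w,z)$ and $L(x,y,z,w)+L(y,z,x,w)+L(z,x,y,w)=0$; it is a Riemannian $P$-tensor if also $L(x,y,Pz,Pw)=L(x,y,z,w)$. (Under the hypotheses, $K$ and $R'$ are Riemannian $P$-tensors.) For such $L$: $\rho(L)(y,z)=g^{ij}L(e_i,y,z,e_j)$, $\tau(L)=g^{ij}\rho(L)(e_i,e_j)$, $\rho^*(L)(y,z)=g^{ij}L(e_i,y,z,Pe_j)$, $\tau^*(L)=g^{ij}\rho^*(L)(e_i,e_j)$. For a $(0,2)$-tensor $S$: $\psi_1(S)(x,y,z,w)=g(y,z)S(x,w)-g(x,z)S(y,w)+S(y,z)g(x,w)-S(x,z)g(y,w)$, $\psi_2(S)(x,y,z,w)=\psi_1(S)(x,y,Pz,Pw)$.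 With $\widetilde g(x,y)=g(x,Py)$: $\pi_1=\frac12\psi_1(g)$, $\pi_2=\frac12\psi_2(g)$, $\pi_3=\psi_1(\widetilde g)=\psi_2(\widetilde g)$. The Bochner tensor of a Riemannian $P$-tensor $L$ (for $\dim M=2n\ge6$) is $$B(L)=L-\frac1{2(n-2)}\Big\{(\psi_1+\psi_2)(\rho(L))-\frac1{2(n-1)}\big[\tau(L)(\pi_1+\pi_2)+\tau^*(L)\pi_3\big]\Big\}.$$ *)

theory Defs
  imports "HOL-Analysis.Analysis"
begin

section \<open>Smooth manifolds\<close>

primrec Ck_on :: "nat \<Rightarrow> 'a::euclidean_space set \<Rightarrow> ('a \<Rightarrow> 'b::real_normed_vector) \<Rightarrow> bool" where
  "Ck_on 0 S f \<longleftrightarrow> continuous_on S f"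
| "Ck_on (Suc k) S f \<longleftrightarrow>
     (\<exists>f'. (\<forall>x\<in>S. (f has_derivative f' x) (at x)) \<and> (\<forall>v. Ck_on k S (\<lambda>x. f' x v)))"

text \<open>Used for open sets only.\<close>

definition smooth_on :: "'a::euclidean_space set \<Rightarrow> ('a \<Rightarrow> 'b::real_normed_vector) \<Rightarrow> bool" where
  "smooth_on S f \<longleftrightarrow> (\<forall>k. Ck_on k S f)"

text \<open>
  The manifold is the whole type \<open>'m\<close>, with its topology, and the model space is \<open>'e\<close>. A chart is
  a domain together with a coordinate map; the values of the map outside the domain are irrelevant.
\<close>

type_synonym ('m, 'e) chart = "'m set \<times> ('m \<Rightarrow> 'e)"

abbreviation chart_image :: "('m, 'e) chart \<Rightarrow> 'e set" where
  "chart_image c \<equiv> snd c ` fst c"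

abbreviation chart_inv :: "('m, 'e) chart \<Rightarrow> 'e \<Rightarrow> 'm" where
  "chart_inv c \<equiv> inv_into (fst c) (snd c)"

definition smooth_atlas ::
  "('m::{t2_space,second_countable_topology}, 'e::euclidean_space) chart set \<Rightarrow> bool" where
  "smooth_atlas A \<longleftrightarrow>
     (\<forall>c\<in>A. open (fst c) \<and> open (chart_image c) \<and>
        homeomorphism (fst c) (chart_image c) (snd c) (chart_inv c)) \<and>
     (\<Union>c\<in>A. fst c) = UNIV \<and>
     (\<forall>c\<in>A. \<forall>d\<in>A. smooth_on (snd c ` (fst c \<inter> fst d)) (snd d \<circ> chart_inv c))"

definition smooth_fun ::
  "('m, 'e::euclidean_space) chart set \<Rightarrow> ('m \<Rightarrow> real) \<Rightarrow> bool" where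
  "smooth_fun A f \<longleftrightarrow> (\<forall>c\<in>A. smooth_on (chart_image c) (f \<circ> chart_inv c))"

text \<open>
  A chart \<open>chart_at A p\<close> around each point \<open>p\<close> is chosen once and for all, and the tangent space at
  \<open>p\<close> is the model space \<open>'e\<close>: a tangent vector at \<open>p\<close> is given by its components in
  \<open>chart_at A p\<close>. Its components in any other chart \<open>c\<close> around \<open>p\<close> are obtained with the
  derivative of the transition map from \<open>chart_at A p\<close> to \<open>c\<close>. Thus vector fields are functions
  \<open>'m \<Rightarrow> 'e\<close>, and a tensor field is a function sending \<open>p\<close> to a multilinear map on \<open>'e\<close>.
\<close>

definition chart_at :: "('m, 'e) chart set \<Rightarrow> 'm \<Rightarrow> ('m, 'e) chart" where
  "chart_at A p = (SOME c. c \<in> A \<and> p \<in> fst c)"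

definition components ::
  "('m, 'e::euclidean_space) chart set \<Rightarrow> ('m, 'e) chart \<Rightarrow> 'm \<Rightarrow> 'e \<Rightarrow> 'e" where
  "components A c p v =
     frechet_derivative (snd c \<circ> chart_inv (chart_at A p)) (at (snd (chart_at A p) p)) v"

definition local_field ::
  "('m, 'e::euclidean_space) chart set \<Rightarrow> ('m, 'e) chart \<Rightarrow> ('m \<Rightarrow> 'e) \<Rightarrow> 'e \<Rightarrow> 'e" where
  "local_field A c X u = components A c (chart_inv c u) (X (chart_inv c u))"

definition vector_field ::
  "('m, 'e::euclidean_space) chart set \<Rightarrow> ('m \<Rightarrow> 'e) \<Rightarrow> bool" where
  "vector_field A X \<longleftrightarrow> (\<forall>c\<in>A. smooth_on (chart_image c) (local_field A c X))"

text \<open>The function \<open>X f\<close>.\<close>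

definition deriv_along ::
  "('m, 'e::euclidean_space) chart set \<Rightarrow> ('m \<Rightarrow> 'e) \<Rightarrow> ('m \<Rightarrow> real) \<Rightarrow> 'm \<Rightarrow> real" where
  "deriv_along A X f p =
     frechet_derivative (f \<circ> chart_inv (chart_at A p)) (at (snd (chart_at A p) p)) (X p)"

text \<open>
  The Lie bracket, \<open>[X,Y]\<^sup>i = X\<^sup>j \<partial>\<^sub>j Y\<^sup>i - Y\<^sup>j \<partial>\<^sub>j X\<^sup>i\<close>, computed at \<open>p\<close> in the chart \<open>chart_at A p\<close>.
\<close>

definition lie_bracket ::
  "('m, 'e::euclidean_space) chart set \<Rightarrow> ('m \<Rightarrow> 'e) \<Rightarrow> ('m \<Rightarrow> 'e) \<Rightarrow> 'm \<Rightarrow> 'e" where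
  "lie_bracket A X Y p =
     (let c = chart_at A p in
        frechet_derivative (local_field A c Y) (at (snd c p)) (X p)
      - frechet_derivative (local_field A c X) (at (snd c p)) (Y p))"

text \<open>
  Expressions such as a curvature tensor are defined on vector fields; their value on tangent
  vectors at \<open>p\<close> is their value on any vector fields extending these vectors.
\<close>

definition extend ::
  "('m, 'e::euclidean_space) chart set \<Rightarrow> 'm \<Rightarrow> 'e \<Rightarrow> 'm \<Rightarrow> 'e" where
  "extend A p v = (SOME X. vector_field A X \<and> X p = v)"

definition closed_1form ::
  "('m, 'e::euclidean_space) chart set \<Rightarrow> ('m \<Rightarrow> 'e \<Rightarrow> real) \<Rightarrow> bool" where
  "closed_1form A \<omega> \<longleftrightarrow>
     (\<forall>X Y. vector_field A X \<longrightarrow> vector_field A Y \<longrightarrow>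
       (\<forall>p. deriv_along A X (\<lambda>q. \<omega> q (Y q)) p - deriv_along A Y (\<lambda>q. \<omega> q (X q)) p
              - \<omega> p (lie_bracket A X Y p) = 0))"

section \<open>Riemannian almost product manifolds\<close>

definition riemannian_metric ::
  "('m, 'e::euclidean_space) chart set \<Rightarrow> ('m \<Rightarrow> 'e \<Rightarrow> 'e \<Rightarrow> real) \<Rightarrow> bool" where
  "riemannian_metric A g \<longleftrightarrow>
     (\<forall>p. bilinear (g p) \<and> (\<forall>u v. g p u v = g p v u) \<and> (\<forall>u. u \<noteq> 0 \<longrightarrow> g p u u > 0)) \<and>
     (\<forall>X Y. vector_field A X \<longrightarrow> vector_field A Y \<longrightarrow> smooth_fun A (\<lambda>p. g p (X p) (Y p)))"

definition tensor_field_11 ::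
  "('m, 'e::euclidean_space) chart set \<Rightarrow> ('m \<Rightarrow> 'e \<Rightarrow> 'e) \<Rightarrow> bool" where
  "tensor_field_11 A P \<longleftrightarrow>
     (\<forall>p. linear (P p)) \<and> (\<forall>X. vector_field A X \<longrightarrow> vector_field A (\<lambda>p. P p (X p)))"

definition riemannian_almost_product_manifold ::
  "('m::{t2_space,second_countable_topology}, 'e::euclidean_space) chart set \<Rightarrow>
   ('m \<Rightarrow> 'e \<Rightarrow> 'e) \<Rightarrow> ('m \<Rightarrow> 'e \<Rightarrow> 'e \<Rightarrow> real) \<Rightarrow> bool" where
  "riemannian_almost_product_manifold A P g \<longleftrightarrow>
     smooth_atlas A \<and> riemannian_metric A g \<and> tensor_field_11 A P \<and>
     (\<forall>p x. P p (P p x) = x) \<and> (\<forall>p x y. g p (P p x) (P p y) = g p x y)"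

definition endo_trace :: "('e::euclidean_space \<Rightarrow> 'e) \<Rightarrow> real" where
  "endo_trace f = (\<Sum>b\<in>Basis. f b \<bullet> b)"

section \<open>Linear connections\<close>

type_synonym ('m, 'e) connection = "('m \<Rightarrow> 'e) \<Rightarrow> ('m \<Rightarrow> 'e) \<Rightarrow> 'm \<Rightarrow> 'e"

definition linear_connection ::
  "('m, 'e::euclidean_space) chart set \<Rightarrow> ('m, 'e) connection \<Rightarrow> bool" where
  "linear_connection A D \<longleftrightarrow>
     (\<forall>X Y. vector_field A X \<longrightarrow> vector_field A Y \<longrightarrow> vector_field A (D X Y)) \<and>
     (\<forall>X X' Y. vector_field A X \<longrightarrow> vector_field A X' \<longrightarrow> vector_field A Y \<longrightarrow>
        D (\<lambda>p. X p + X' p) Y = (\<lambda>p. D X Y p + D X' Y p)) \<and>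
     (\<forall>f X Y. smooth_fun A f \<longrightarrow> vector_field A X \<longrightarrow> vector_field A Y \<longrightarrow>
        D (\<lambda>p. f p *\<^sub>R X p) Y = (\<lambda>p. f p *\<^sub>R D X Y p)) \<and>
     (\<forall>X Y Y'. vector_field A X \<longrightarrow> vector_field A Y \<longrightarrow> vector_field A Y' \<longrightarrow>
        D X (\<lambda>p. Y p + Y' p) = (\<lambda>p. D X Y p + D X Y' p)) \<and>
     (\<forall>f X Y. smooth_fun A f \<longrightarrow> vector_field A X \<longrightarrow> vector_field A Y \<longrightarrow>
        D X (\<lambda>p. f p *\<^sub>R Y p) = (\<lambda>p. deriv_along A X f p *\<^sub>R Y p + f p *\<^sub>R D X Y p))"

definition torsion ::
  "('m, 'e::euclidean_space) chart set \<Rightarrow> ('m, 'e) connection \<Rightarrow>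
   ('m \<Rightarrow> 'e) \<Rightarrow> ('m \<Rightarrow> 'e) \<Rightarrow> 'm \<Rightarrow> 'e" where
  "torsion A D X Y p = D X Y p - D Y X p - lie_bracket A X Y p"

definition cov_deriv_metric ::
  "('m, 'e::euclidean_space) chart set \<Rightarrow> ('m, 'e) connection \<Rightarrow> ('m \<Rightarrow> 'e \<Rightarrow> 'e \<Rightarrow> real) \<Rightarrow>
   ('m \<Rightarrow> 'e) \<Rightarrow> ('m \<Rightarrow> 'e) \<Rightarrow> ('m \<Rightarrow> 'e) \<Rightarrow> 'm \<Rightarrow> real" where
  "cov_deriv_metric A D g X Y Z p =
     deriv_along A X (\<lambda>q. g q (Y q) (Z q)) p - g p (D X Y p) (Z p) - g p (Y p) (D X Z p)"

definition cov_deriv_endo ::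
  "('m, 'e::euclidean_space) connection \<Rightarrow> ('m \<Rightarrow> 'e \<Rightarrow> 'e) \<Rightarrow>
   ('m \<Rightarrow> 'e) \<Rightarrow> ('m \<Rightarrow> 'e) \<Rightarrow> 'm \<Rightarrow> 'e" where
  "cov_deriv_endo D P X Y p = D X (\<lambda>q. P q (Y q)) p - P p (D X Y p)"

definition metric_parallel ::
  "('m, 'e::euclidean_space) chart set \<Rightarrow> ('m, 'e) connection \<Rightarrow> ('m \<Rightarrow> 'e \<Rightarrow> 'e \<Rightarrow> real) \<Rightarrow> bool" where
  "metric_parallel A D g \<longleftrightarrow>
     (\<forall>X Y Z. vector_field A X \<longrightarrow> vector_field A Y \<longrightarrow> vector_field A Z \<longrightarrow>
       (\<forall>p. cov_deriv_metric A D g X Y Z p = 0))"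

definition endo_parallel ::
  "('m, 'e::euclidean_space) chart set \<Rightarrow> ('m, 'e) connection \<Rightarrow> ('m \<Rightarrow> 'e \<Rightarrow> 'e) \<Rightarrow> bool" where
  "endo_parallel A D P \<longleftrightarrow>
     (\<forall>X Y. vector_field A X \<longrightarrow> vector_field A Y \<longrightarrow> (\<forall>p. cov_deriv_endo D P X Y p = 0))"

definition levi_civita ::
  "('m, 'e::euclidean_space) chart set \<Rightarrow> ('m \<Rightarrow> 'e \<Rightarrow> 'e \<Rightarrow> real) \<Rightarrow> ('m, 'e) connection \<Rightarrow> bool" where
  "levi_civita A g D \<longleftrightarrow>
     linear_connection A D \<and> metric_parallel A D g \<and>
     (\<forall>X Y. vector_field A X \<longrightarrow> vector_field A Y \<longrightarrow> (\<forall>p. torsion A D X Y p = 0))"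

definition curvature ::
  "('m, 'e::euclidean_space) chart set \<Rightarrow> ('m, 'e) connection \<Rightarrow>
   ('m \<Rightarrow> 'e) \<Rightarrow> ('m \<Rightarrow> 'e) \<Rightarrow> ('m \<Rightarrow> 'e) \<Rightarrow> 'm \<Rightarrow> 'e" where
  "curvature A D X Y Z p = D X (D Y Z) p - D Y (D X Z) p - D (lie_bracket A X Y) Z p"

text \<open>The curvature tensor of type \<open>(0,4)\<close> on tangent vectors at \<open>p\<close>.\<close>

definition curvature_tensor ::
  "('m, 'e::euclidean_space) chart set \<Rightarrow> ('m \<Rightarrow> 'e \<Rightarrow> 'e \<Rightarrow> real) \<Rightarrow> ('m, 'e) connection \<Rightarrow>
   'm \<Rightarrow> 'e \<Rightarrow> 'e \<Rightarrow> 'e \<Rightarrow> 'e \<Rightarrow> real" where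
  "curvature_tensor A g D p x y z w =
     g p (curvature A D (extend A p x) (extend A p y) (extend A p z) p) w"

definition K_tensor ::
  "('m, 'e::euclidean_space) chart set \<Rightarrow> ('m \<Rightarrow> 'e \<Rightarrow> 'e) \<Rightarrow> ('m \<Rightarrow> 'e \<Rightarrow> 'e \<Rightarrow> real) \<Rightarrow>
   ('m, 'e) connection \<Rightarrow> 'm \<Rightarrow> 'e \<Rightarrow> 'e \<Rightarrow> 'e \<Rightarrow> 'e \<Rightarrow> real" where
  "K_tensor A P g D p x y z w =
     1/2 * (curvature_tensor A g D p x y z w + curvature_tensor A g D p x y (P p z) (P p w))"

section \<open>Algebra at a point\<close>

text \<open>
  Below \<open>g\<close> and \<open>P\<close> are the values of the metric and of the almost product structure at a point.
  The components \<open>g\<^sup>i\<^sup>j\<close> refer to the basis \<open>Basis\<close> of the tangent space \<open>'e\<close>, which need not be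
  \<open>g\<close>-orthonormal; contractions do not depend on the basis. The function \<open>inverse_metric g\<close> is
  meaningful on \<open>Basis\<close> only.
\<close>

definition inverse_metric :: "('e::euclidean_space \<Rightarrow> 'e \<Rightarrow> real) \<Rightarrow> 'e \<Rightarrow> 'e \<Rightarrow> real" where
  "inverse_metric g =
     (SOME h. \<forall>i\<in>Basis. \<forall>k\<in>Basis. (\<Sum>j\<in>Basis. h i j * g j k) = (if i = k then 1 else 0))"

definition contract ::
  "('e::euclidean_space \<Rightarrow> 'e \<Rightarrow> real) \<Rightarrow> ('e \<Rightarrow> 'e \<Rightarrow> real) \<Rightarrow> real" where
  "contract g S = (\<Sum>i\<in>Basis. \<Sum>j\<in>Basis. inverse_metric g i j * S i j)"

type_synonym 'e tensor2 = "'e \<Rightarrow> 'e \<Rightarrow> real"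
type_synonym 'e tensor4 = "'e \<Rightarrow> 'e \<Rightarrow> 'e \<Rightarrow> 'e \<Rightarrow> real"

definition ricci :: "'e::euclidean_space tensor2 \<Rightarrow> 'e tensor4 \<Rightarrow> 'e tensor2" where
  "ricci g L y z = contract g (\<lambda>a b. L a y z b)"

definition scal :: "'e::euclidean_space tensor2 \<Rightarrow> 'e tensor4 \<Rightarrow> real" where
  "scal g L = contract g (ricci g L)"

definition ricci_star ::
  "'e::euclidean_space tensor2 \<Rightarrow> ('e \<Rightarrow> 'e) \<Rightarrow> 'e tensor4 \<Rightarrow> 'e tensor2" where
  "ricci_star g P L y z = contract g (\<lambda>a b. L a y z (P b))"

definition scal_star ::
  "'e::euclidean_space tensor2 \<Rightarrow> ('e \<Rightarrow> 'e) \<Rightarrow> 'e tensor4 \<Rightarrow> real" where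
  "scal_star g P L = contract g (ricci_star g P L)"

definition psi1 :: "'e tensor2 \<Rightarrow> 'e tensor2 \<Rightarrow> 'e tensor4" where
  "psi1 g S x y z w = g y z * S x w - g x z * S y w + S y z * g x w - S x z * g y w"

definition psi2 :: "'e tensor2 \<Rightarrow> ('e \<Rightarrow> 'e) \<Rightarrow> 'e tensor2 \<Rightarrow> 'e tensor4" where
  "psi2 g P S x y z w = psi1 g S x y (P z) (P w)"

definition pi1 :: "'e tensor2 \<Rightarrow> 'e tensor4" where
  "pi1 g x y z w = 1/2 * psi1 g g x y z w"

definition pi2 :: "'e tensor2 \<Rightarrow> ('e \<Rightarrow> 'e) \<Rightarrow> 'e tensor4" where
  "pi2 g P x y z w = 1/2 * psi2 g P g x y z w"

definition pi3 :: "'e tensor2 \<Rightarrow> ('e \<Rightarrow> 'e) \<Rightarrow> 'e tensor4" where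
  "pi3 g P = psi1 g (\<lambda>x y. g x (P y))"

text \<open>Here \<open>2n\<close> is the dimension; the formula is meant for \<open>2n \<ge> 6\<close> and Riemannian \<open>P\<close>-tensors \<open>L\<close>.\<close>

definition bochner ::
  "nat \<Rightarrow> 'e::euclidean_space tensor2 \<Rightarrow> ('e \<Rightarrow> 'e) \<Rightarrow> 'e tensor4 \<Rightarrow> 'e tensor4" where
  "bochner n g P L x y z w =
     L x y z w - 1 / (2 * (real n - 2)) *
       (psi1 g (ricci g L) x y z w + psi2 g P (ricci g L) x y z w
        - 1 / (2 * (real n - 1)) *
            (scal g L * (pi1 g x y z w + pi2 g P x y z w) + scal_star g P L * pi3 g P x y z w))"

section \<open>The classes and the natural connections\<close>

text \<open>In the following definitions \<open>D\<close> is the Levi-Civita connection of \<open>g\<close>.\<close>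

definition F_tensor ::
  "('m, 'e::euclidean_space) connection \<Rightarrow> ('m \<Rightarrow> 'e \<Rightarrow> 'e) \<Rightarrow> ('m \<Rightarrow> 'e \<Rightarrow> 'e \<Rightarrow> real) \<Rightarrow>
   ('m \<Rightarrow> 'e) \<Rightarrow> ('m \<Rightarrow> 'e) \<Rightarrow> ('m \<Rightarrow> 'e) \<Rightarrow> 'm \<Rightarrow> real" where
  "F_tensor D P g X Y Z p = g p (cov_deriv_endo D P X Y p) (Z p)"

definition theta_form ::
  "('m, 'e::euclidean_space) chart set \<Rightarrow> ('m \<Rightarrow> 'e \<Rightarrow> 'e) \<Rightarrow> ('m \<Rightarrow> 'e \<Rightarrow> 'e \<Rightarrow> real) \<Rightarrow>
   ('m, 'e) connection \<Rightarrow> 'm \<Rightarrow> 'e \<Rightarrow> real" where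
  "theta_form A P g D p x =
     contract (g p) (\<lambda>a b. F_tensor D P g (extend A p a) (extend A p b) (extend A p x) p)"

definition class_W3 ::
  "nat \<Rightarrow> ('m, 'e::euclidean_space) chart set \<Rightarrow> ('m \<Rightarrow> 'e \<Rightarrow> 'e) \<Rightarrow> ('m \<Rightarrow> 'e \<Rightarrow> 'e \<Rightarrow> real) \<Rightarrow>
   ('m, 'e) connection \<Rightarrow> bool" where
  "class_W3 n A P g D \<longleftrightarrow>
     (let \<theta> = theta_form A P g D in
       (\<forall>X Y Z. vector_field A X \<longrightarrow> vector_field A Y \<longrightarrow> vector_field A Z \<longrightarrow>
         (\<forall>p. F_tensor D P g X Y Z p = 1 / (2 * real n) *
            ((g p (X p) (Y p) + g p (X p) (P p (Y p))) * \<theta> p (Z p)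
             + (g p (X p) (Z p) + g p (X p) (P p (Z p))) * \<theta> p (Y p)))) \<and>
       (\<forall>p x. \<theta> p (P p x) = - \<theta> p x))"

definition class_W6 ::
  "nat \<Rightarrow> ('m, 'e::euclidean_space) chart set \<Rightarrow> ('m \<Rightarrow> 'e \<Rightarrow> 'e) \<Rightarrow> ('m \<Rightarrow> 'e \<Rightarrow> 'e \<Rightarrow> real) \<Rightarrow>
   ('m, 'e) connection \<Rightarrow> bool" where
  "class_W6 n A P g D \<longleftrightarrow>
     (let \<theta> = theta_form A P g D in
       (\<forall>X Y Z. vector_field A X \<longrightarrow> vector_field A Y \<longrightarrow> vector_field A Z \<longrightarrow>
         (\<forall>p. F_tensor D P g X Y Z p = 1 / (2 * real n) *
            ((g p (X p) (Y p) - g p (X p) (P p (Y p))) * \<theta> p (Z p)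
             + (g p (X p) (Z p) - g p (X p) (P p (Z p))) * \<theta> p (Y p)))) \<and>
       (\<forall>p x. \<theta> p (P p x) = \<theta> p x))"

text \<open>
  \<open>D'\<close> is a natural connection, belonging to the 2-parameter family of natural connections
  through its torsion.
\<close>

definition natural_connection ::
  "nat \<Rightarrow> ('m, 'e::euclidean_space) chart set \<Rightarrow> ('m \<Rightarrow> 'e \<Rightarrow> 'e) \<Rightarrow> ('m \<Rightarrow> 'e \<Rightarrow> 'e \<Rightarrow> real) \<Rightarrow>
   ('m, 'e) connection \<Rightarrow> ('m, 'e) connection \<Rightarrow> bool" where
  "natural_connection n A P g D D' \<longleftrightarrow>
     linear_connection A D' \<and> endo_parallel A D' P \<and> metric_parallel A D' g \<and>
     (\<exists>l m::real. \<forall>X Y Z. vector_field A X \<longrightarrow> vector_field A Y \<longrightarrow> vector_field A Z \<longrightarrow>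
       (\<forall>p. let \<theta> = theta_form A P g D p; G = g p; Q = P p; x = X p; y = Y p; z = Z p in
         G (torsion A D' X Y p) z =
           1 / (2 * real n) * (G y z * \<theta> (Q x) - G x z * \<theta> (Q y))
           + l * (G y z * \<theta> x - G x z * \<theta> y + G y (Q z) * \<theta> (Q x) - G x (Q z) * \<theta> (Q y))
           + m * (G y (Q z) * \<theta> x - G x (Q z) * \<theta> y + G y z * \<theta> (Q x) - G x z * \<theta> (Q y))))"

end

theory Submission
  imports Defs
begin

text \<open>
  Let \<open>\<epsilon> = 1\<close> for the class \<open>W3\<close> and \<open>\<epsilon> = -1\<close> for the class \<open>W6\<close>, so that \<open>\<theta> \<circ> P = -\<epsilon> \<theta>\<close>. On such a
  manifold the torsion of a natural connection \<open>\<nabla>'\<close> is \<open>T(x,y) = \<theta>(x) J y - \<theta>(y) J x\<close> with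
  \<open>J = c I + d P\<close> for two constants \<open>c\<close> and \<open>d\<close>. Since \<open>\<nabla>\<close> and \<open>\<nabla>'\<close> are both metric, \<open>Q = \<nabla>' - \<nabla>\<close> is
  \<open>Q(x,y) = h(x,y) \<Omega> - \<theta>(y) J x\<close>, where \<open>h(x,y) = g(J x,y)\<close> and \<open>\<Omega>\<close> is the dual vector of \<open>\<theta>\<close>.

  Write \<open>S = \<nabla>' \<theta>\<close>. It satisfies \<open>S(x,P y) = -\<epsilon> S(x,y)\<close> because \<open>\<nabla>' P = 0\<close>, and it is symmetric because
  \<open>\<theta>\<close> is closed and vanishes on the values of \<open>T\<close>. As \<open>g\<close>, \<open>P\<close> and hence \<open>h\<close> are parallel for \<open>\<nabla>'\<close>, the
  difference \<open>R' - R\<close> consists of products of \<open>h\<close> with \<open>S\<close> and of terms quadratic in \<open>Q\<close>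
  (\<open>curvature_difference\<close>). Averaging over \<open>(z,w)\<close> and \<open>(P z,P w)\<close> turns \<open>R\<close> into \<open>K\<close> and leaves \<open>R'\<close>
  unchanged; terms with products such as \<open>\<theta>(x) \<theta>(w)\<close> cancel, and everything else has the form \<open>(\<psi>\<^sub>1 + \<psi>\<^sub>2)(S')\<close>, where
  \<open>S'\<close> is symmetric and \<open>P\<close>-invariant, namely a combination of \<open>S\<close>, \<open>g\<close> and \<open>g(\<cdot>,P\<cdot>)\<close>
  (\<open>average_curvature_difference\<close>). So \<open>R' = K + (\<psi>\<^sub>1 + \<psi>\<^sub>2)(S')\<close>. The Bochner tensor is additive
  (\<open>bochner_add\<close>) and annihilates \<open>(\<psi>\<^sub>1 + \<psi>\<^sub>2)(S')\<close> (\<open>bochner_psi\<close>), which is the theorem.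

  Curvature tensors are evaluated on arbitrarily chosen extensions of tangent vectors. Extensions
  exist because bump functions do (\<open>vector_field_extension\<close>). The choice matters where \<open>P\<close> meets
  an extension, since the extension of \<open>P z\<close> is not \<open>P\<close> applied to the extension of \<open>z\<close>. There
  \<open>S\<close> and \<open>R'\<close> are shown to be tensors (\<open>tensorial_zero\<close>, \<open>curvature_tensorial\<close>); for \<open>R'\<close> this
  rests on \<open>[X,Y] f = X (Y f) - Y (X f)\<close>, that is, on the symmetry of second derivatives. Finally,
  \<open>\<theta>\<close> is differentiable because near each point it is the quotient of the smooth functions
  \<open>n F(V,V,\<cdot>)\<close> and \<open>g(V,V)\<close> for a suitable field \<open>V\<close>.
\<close>

section \<open>Calculus of smooth functions\<close>

lemma Ck_on_subset: "Ck_on k S f \<Longrightarrow> T \<subseteq> S \<Longrightarrow> Ck_on k T f"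
proof (induction k arbitrary: f)
  case 0
  then show ?case by (auto intro: continuous_on_subset)
next
  case (Suc k)
  then show ?case by (simp, meson subset_eq)
qed

lemma Ck_on_cong:
  assumes "open S" "\<And>x. x \<in> S \<Longrightarrow> f x = g x" "Ck_on k S f"
  shows "Ck_on k S g"
proof (cases k)
  case 0
  then show ?thesis using assms by (simp cong: continuous_on_cong)
next
  case (Suc j)
  then obtain f' where f': "\<And>x. x \<in> S \<Longrightarrow> (f has_derivative f' x) (at x)"
    "\<And>v. Ck_on j S (\<lambda>x. f' x v)" using assms(3) by auto
  have "(g has_derivative f' x) (at x)" if "x \<in> S" for x
    using has_derivative_transform_within_open[OF f'(1)[OF that] assms(1) that assms(2)] by simp
  then show ?thesis using Suc f'(2) by auto
qed

text \<open>
  On open sets derivatives are unique, so the derivative quantified in the definition of \<open>Ck_on\<close>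
  can be taken to be \<open>frechet_derivative\<close>.
\<close>

lemma Ck_on_Suc_iff:
  assumes "open S"
  shows "Ck_on (Suc k) S f \<longleftrightarrow>
    (\<forall>x\<in>S. f differentiable (at x)) \<and> (\<forall>v. Ck_on k S (\<lambda>x. frechet_derivative f (at x) v))"
    (is "?L \<longleftrightarrow> ?R")
proof
  assume ?L
  then obtain f' where f': "\<And>x. x \<in> S \<Longrightarrow> (f has_derivative f' x) (at x)"
    "\<And>v. Ck_on k S (\<lambda>x. f' x v)" by auto
  have "frechet_derivative f (at x) = f' x" if "x \<in> S" for x
    using f'(1)[OF that] by (metis frechet_derivative_at)
  then have "Ck_on k S (\<lambda>x. frechet_derivative f (at x) v)" for v
    using Ck_on_cong[OF assms _ f'(2)[of v]] by simp
  then show ?R using f'(1) by (auto simp: differentiable_def)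
next
  assume ?R
  then show ?L by (auto simp: frechet_derivative_works)
qed

lemma Ck_on_Suc_imp: "Ck_on (Suc k) S f \<Longrightarrow> Ck_on k S f"
proof (induction k arbitrary: f)
  case 0
  then show ?case
    by (metis Ck_on.simps continuous_at_imp_continuous_on has_derivative_continuous)
next
  case (Suc k)
  then show ?case by (metis Ck_on.simps(2))
qed

lemma Ck_on_local:
  assumes "open S" "\<And>x. x \<in> S \<Longrightarrow> \<exists>U. open U \<and> x \<in> U \<and> Ck_on k U f"
  shows "Ck_on k S f"
  using assms(2)
proof (induction k arbitrary: f)
  case 0
  have "isCont f x" if x: "x \<in> S" for x
  proof -
    obtain U where "open U" "x \<in> U" "Ck_on 0 U f" using 0[OF x] by blast
    then show ?thesis using continuous_on_eq_continuous_at[of U f] by simp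
  qed
  then show ?case by (simp add: continuous_at_imp_continuous_on)
next
  case (Suc k)
  have *: "f differentiable (at x) \<and> (\<exists>U. open U \<and> x \<in> U \<and> (\<forall>v. Ck_on k U (\<lambda>x. frechet_derivative f (at x) v)))"
    if x: "x \<in> S" for x
  proof -
    obtain U where U: "open U" "x \<in> U" "Ck_on (Suc k) U f" using Suc.prems[OF x] by blast
    then show ?thesis using Ck_on_Suc_iff[OF U(1), of k f] by blast
  qed
  have "Ck_on k S (\<lambda>x. frechet_derivative f (at x) v)" for v
    using * by (intro Suc.IH) blast
  with * show ?case unfolding Ck_on_Suc_iff[OF assms(1)] by blast
qed

lemma Ck_on_SucI:
  assumes "\<And>x. x \<in> S \<Longrightarrow> (f has_derivative f' x) (at x)" "\<And>v. Ck_on k S (\<lambda>x. f' x v)"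
  shows "Ck_on (Suc k) S f"
  using assms by (auto intro!: exI[of _ f'])

lemma Ck_on_SucE:
  assumes "Ck_on (Suc k) S f"
  obtains f' where "\<And>x. x \<in> S \<Longrightarrow> (f has_derivative f' x) (at x)" "\<And>v. Ck_on k S (\<lambda>x. f' x v)"
  using assms by auto

lemma Ck_on_const: "Ck_on k S (\<lambda>x. c)"
proof (induction k arbitrary: c)
  case (Suc k)
  then show ?case by (intro Ck_on_SucI[where f' = "\<lambda>x v. 0"]) auto
qed simp

lemma Ck_on_bounded_linear:
  assumes "bounded_linear f" shows "Ck_on k S f"
proof (cases k)
  case 0
  then show ?thesis
    using assms by (simp add: bounded_linear.linear linear_continuous_on)
next
  case (Suc j)
  then show ?thesis
    using assms by (auto intro!: exI[of _ "\<lambda>x. f"] bounded_linear_imp_has_derivative Ck_on_const)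
qed

lemma Ck_on_add: "Ck_on k S f \<Longrightarrow> Ck_on k S g \<Longrightarrow> Ck_on k S (\<lambda>x. f x + g x)"
proof (induction k arbitrary: f g)
  case 0
  then show ?case by (auto intro: continuous_intros)
next
  case (Suc k)
  obtain f' g' where
    "\<And>x. x \<in> S \<Longrightarrow> (f has_derivative f' x) (at x)" "\<And>v. Ck_on k S (\<lambda>x. f' x v)"
    "\<And>x. x \<in> S \<Longrightarrow> (g has_derivative g' x) (at x)" "\<And>v. Ck_on k S (\<lambda>x. g' x v)"
    using Suc.prems by (elim Ck_on_SucE) blast
  then show ?case
    by (intro Ck_on_SucI[where f' = "\<lambda>x v. f' x v + g' x v"] has_derivative_add Suc.IH)
qed

lemma Ck_on_bilinear:
  assumes B: "bounded_bilinear B"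
  shows "Ck_on k S f \<Longrightarrow> Ck_on k S g \<Longrightarrow> Ck_on k S (\<lambda>x. B (f x) (g x))"
proof (induction k arbitrary: f g)
  case 0
  then show ?case using bounded_bilinear.continuous_on[OF B] by auto
next
  case (Suc k)
  obtain f' g' where f'g':
    "\<And>x. x \<in> S \<Longrightarrow> (f has_derivative f' x) (at x)" "\<And>v. Ck_on k S (\<lambda>x. f' x v)"
    "\<And>x. x \<in> S \<Longrightarrow> (g has_derivative g' x) (at x)" "\<And>v. Ck_on k S (\<lambda>x. g' x v)"
    using Suc.prems by (elim Ck_on_SucE) blast
  have "Ck_on k S (\<lambda>x. B (f x) (g' x v) + B (f' x v) (g x))" for v
    using f'g' by (intro Ck_on_add Suc.IH Ck_on_Suc_imp[OF Suc.prems(1)] Ck_on_Suc_imp[OF Suc.prems(2)])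
  then show ?case
    using f'g'
    by (intro Ck_on_SucI[where f' = "\<lambda>x v. B (f x) (g' x v) + B (f' x v) (g x)"]
          bounded_bilinear.FDERIV[OF B])
qed

lemma Ck_on_sum:
  "(\<And>i. i \<in> I \<Longrightarrow> Ck_on k S (f i)) \<Longrightarrow> Ck_on k S (\<lambda>x. \<Sum>i\<in>I. f i x)"
proof (induction I rule: infinite_finite_induct)
  case (insert i I)
  then show ?case by (simp add: Ck_on_add)
qed (auto simp: Ck_on_const)

lemma Ck_on_compose:
  fixes f :: "'b::euclidean_space \<Rightarrow> 'c::real_normed_vector" and g :: "'a::euclidean_space \<Rightarrow> 'b"
  assumes "open S" "open T" "g ` S \<subseteq> T"
  shows "Ck_on k T f \<Longrightarrow> Ck_on k S g \<Longrightarrow> Ck_on k S (\<lambda>x. f (g x))"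
proof (induction k arbitrary: f)
  case 0
  then show ?case using assms by (auto intro: continuous_on_compose2)
next
  case (Suc k)
  have f: "f differentiable (at y)" if "y \<in> T" for y
    using Suc.prems Ck_on_Suc_iff[OF assms(2)] that by blast
  have g: "g differentiable (at x)" if "x \<in> S" for x
    using Suc.prems Ck_on_Suc_iff[OF assms(1)] that by blast
  let ?D = "\<lambda>x v. frechet_derivative f (at (g x)) (frechet_derivative g (at x) v)"
  have D: "((\<lambda>x. f (g x)) has_derivative ?D x) (at x)" if "x \<in> S" for x
    using has_derivative_compose[of g "frechet_derivative g (at x)" x UNIV f] f g that assms(3)
    by (auto simp: frechet_derivative_works)
  \<comment> \<open>The derivative of the composition is a finite sum of products to which the induction hypothesis applies.\<close>
  have eq: "?D x v = (\<Sum>b\<in>Basis. (frechet_derivative g (at x) v \<bullet> b) *\<^sub>R frechet_derivative f (at (g x)) b)"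
    if "x \<in> S" for x v
  proof -
    have "linear (frechet_derivative f (at (g x)))"
      using f that assms(3) by (auto intro: linear_frechet_derivative)
    then show ?thesis
      by (subst euclidean_representation[of "frechet_derivative g (at x) v", symmetric])
         (simp only: linear_sum linear_scale)
  qed
  have "Ck_on k S (\<lambda>x. ?D x v)" for v
  proof (rule Ck_on_cong[OF assms(1), rotated])
    show "Ck_on k S (\<lambda>x. \<Sum>b\<in>Basis. (frechet_derivative g (at x) v \<bullet> b) *\<^sub>R frechet_derivative f (at (g x)) b)"
      using Suc.prems(1)[unfolded Ck_on_Suc_iff[OF assms(2)]]
        Suc.prems(2)[unfolded Ck_on_Suc_iff[OF assms(1)]]
      by (intro Ck_on_sum Ck_on_bilinear[OF bounded_bilinear_scaleR]
            Ck_on_bilinear[OF bounded_bilinear_inner] Ck_on_const Suc.IH Ck_on_Suc_imp[OF Suc.prems(2)])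
         simp_all
  qed (simp add: eq)
  with D show ?case by (rule Ck_on_SucI)
qed

lemma smooth_on_subset: "smooth_on S f \<Longrightarrow> T \<subseteq> S \<Longrightarrow> smooth_on T f"
  unfolding smooth_on_def using Ck_on_subset by blast

lemma smooth_on_cong:
  "open S \<Longrightarrow> (\<And>x. x \<in> S \<Longrightarrow> f x = g x) \<Longrightarrow> smooth_on S f \<Longrightarrow> smooth_on S g"
  unfolding smooth_on_def using Ck_on_cong[of S f g] by blast

lemma smooth_on_local:
  "open S \<Longrightarrow> (\<And>x. x \<in> S \<Longrightarrow> \<exists>U. open U \<and> x \<in> U \<and> smooth_on U f) \<Longrightarrow> smooth_on S f"
  unfolding smooth_on_def by (intro allI Ck_on_local) blast+

lemma smooth_on_const: "smooth_on S (\<lambda>x. c)"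
  and smooth_on_bounded_linear: "bounded_linear f \<Longrightarrow> smooth_on S f"
  and smooth_on_add: "smooth_on S f \<Longrightarrow> smooth_on S g \<Longrightarrow> smooth_on S (\<lambda>x. f x + g x)"
  and smooth_on_bilinear:
    "bounded_bilinear B \<Longrightarrow> smooth_on S f' \<Longrightarrow> smooth_on S g' \<Longrightarrow> smooth_on S (\<lambda>x. B (f' x) (g' x))"
  and smooth_on_sum:
    "(\<And>i. i \<in> I \<Longrightarrow> smooth_on S (F i)) \<Longrightarrow> smooth_on S (\<lambda>x. \<Sum>i\<in>I. F i x)"
  by (simp_all add: smooth_on_def Ck_on_const Ck_on_bounded_linear Ck_on_add Ck_on_bilinear Ck_on_sum)

lemmas smooth_on_scaleR = smooth_on_bilinear[OF bounded_bilinear_scaleR]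
  and smooth_on_mult = smooth_on_bilinear[OF bounded_bilinear_mult]
  and smooth_on_inner = smooth_on_bilinear[OF bounded_bilinear_inner]

lemma smooth_on_compose:
  fixes f :: "'b::euclidean_space \<Rightarrow> 'c::real_normed_vector" and g :: "'a::euclidean_space \<Rightarrow> 'b"
  shows "open S \<Longrightarrow> open T \<Longrightarrow> g ` S \<subseteq> T \<Longrightarrow> smooth_on T f \<Longrightarrow> smooth_on S g \<Longrightarrow>
    smooth_on S (\<lambda>x. f (g x))"
  unfolding smooth_on_def using Ck_on_compose[of S T g _ f] by blast

lemma smooth_on_differentiable:
  "smooth_on S f \<Longrightarrow> open S \<Longrightarrow> x \<in> S \<Longrightarrow> f differentiable (at x)"
  using Ck_on_Suc_iff[of S 0 f] by (simp add: smooth_on_def)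

lemma smooth_on_continuous: "smooth_on S f \<Longrightarrow> continuous_on S f"
  by (auto simp: smooth_on_def dest: spec[of _ 0])

lemma smooth_on_derivative:
  "smooth_on S f \<Longrightarrow> open S \<Longrightarrow> smooth_on S (\<lambda>x. frechet_derivative f (at x) v)"
  using Ck_on_Suc_iff[of S _ f] by (simp add: smooth_on_def)

lemma smooth_on_derivative_along:
  fixes f :: "'a::euclidean_space \<Rightarrow> 'b::real_normed_vector"
  assumes "smooth_on S f" "open S" "smooth_on S V"
  shows "smooth_on S (\<lambda>x. frechet_derivative f (at x) (V x))"
proof (rule smooth_on_cong[OF assms(2), rotated])
  show "smooth_on S (\<lambda>x. \<Sum>b\<in>Basis. (V x \<bullet> b) *\<^sub>R frechet_derivative f (at x) b)"
    using assms by (intro smooth_on_sum smooth_on_scaleR smooth_on_inner smooth_on_const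
        smooth_on_derivative)
  fix x assume "x \<in> S"
  then have "linear (frechet_derivative f (at x))"
    using assms by (auto intro: linear_frechet_derivative smooth_on_differentiable)
  then show "(\<Sum>b\<in>Basis. (V x \<bullet> b) *\<^sub>R frechet_derivative f (at x) b) = frechet_derivative f (at x) (V x)"
    by (subst (2) euclidean_representation[of "V x", symmetric])
       (simp only: linear_sum linear_scale)
qed

section \<open>Smooth bump functions\<close>

text \<open>
  The functions \<open>e\<^sup>-\<^sup>1\<^sup>/\<^sup>t t\<^sup>-\<^sup>n\<close>, extended by \<open>0\<close> to \<open>t \<le> 0\<close>. Derivatives of members of
  this family are linear combinations of members, so smoothness of all of them follows by one
  induction.
\<close>

definition flat_exp :: "nat \<Rightarrow> real \<Rightarrow> real" where
  "flat_exp n t = (if t \<le> 0 then 0 else exp (- (1 / t)) / t ^ n)"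

lemma flat_exp_tendsto: "((\<lambda>t. exp (- (1 / t)) / t ^ n) \<longlongrightarrow> 0) (at_right (0::real))"
proof -
  have "((\<lambda>s::real. s ^ n / exp s) \<longlongrightarrow> 0) at_top" by (rule tendsto_power_div_exp_0)
  then have "((\<lambda>t::real. (inverse t) ^ n / exp (inverse t)) \<longlongrightarrow> 0) (at_right 0)"
    by (rule filterlim_compose[OF _ filterlim_inverse_at_top_right])
  then show ?thesis by (simp add: exp_minus field_simps power_inverse)
qed

lemma flat_exp_has_derivative:
  "(flat_exp n has_derivative (\<lambda>v. v * (flat_exp (n+2) t - real n * flat_exp (n+1) t))) (at t)"
proof -
  consider "t < 0" | "t = 0" | "t > 0" by linarith
  then have "(flat_exp n has_real_derivative (flat_exp (n+2) t - real n * flat_exp (n+1) t)) (at t)"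
  proof cases
    case 1
    have "((\<lambda>t. 0::real) has_real_derivative 0) (at t)" by simp
    then have "(flat_exp n has_real_derivative 0) (at t)"
      by (rule has_field_derivative_transform_within_open[where S = "{..<0}"])
         (use 1 in \<open>auto simp: flat_exp_def\<close>)
    then show ?thesis using 1 by (simp add: flat_exp_def)
  next
    case 2
    have "((\<lambda>h. (flat_exp n (0 + h) - flat_exp n 0) / h) \<longlongrightarrow> 0) (at 0)"
    proof (rule filterlim_split_at)
      show "((\<lambda>h. (flat_exp n (0 + h) - flat_exp n 0) / h) \<longlongrightarrow> 0) (at_left 0)"
        by (rule tendsto_eventually) (auto simp: flat_exp_def eventually_at_filter)
      have "eventually (\<lambda>h::real. exp (- (1 / h)) / h ^ (Suc n) = (flat_exp n (0 + h) - flat_exp n 0) / h) (at_right 0)"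
        by (auto simp: flat_exp_def eventually_at_filter)
      from Lim_transform_eventually[OF flat_exp_tendsto this]
      show "((\<lambda>h. (flat_exp n (0 + h) - flat_exp n 0) / h) \<longlongrightarrow> 0) (at_right 0)" .
    qed
    then show ?thesis using 2 by (simp add: DERIV_def flat_exp_def)
  next
    case 3
    have "((\<lambda>t. exp (- (1 / t)) / t ^ n) has_real_derivative
        (exp (- (1 / t)) * (1 / (t * t)) * t ^ n - exp (- (1 / t)) * (real n * t ^ (n - 1))) / (t ^ n * t ^ n)) (at t)"
      using 3 by (auto intro!: derivative_eq_intros)
    moreover have "(exp (- (1 / t)) * (1 / (t * t)) * t ^ n - exp (- (1 / t)) * (real n * t ^ (n - 1))) / (t ^ n * t ^ n)
       = flat_exp (n+2) t - real n * flat_exp (n+1) t"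
      using 3 by (cases n) (simp_all add: flat_exp_def field_simps)
    ultimately have "((\<lambda>t. exp (- (1 / t)) / t ^ n) has_real_derivative
        (flat_exp (n+2) t - real n * flat_exp (n+1) t)) (at t)" by simp
    then show ?thesis
      by (rule has_field_derivative_transform_within_open[where S = "{0<..}"])
         (use 3 in \<open>auto simp: flat_exp_def\<close>)
  qed
  then show ?thesis
    unfolding has_field_derivative_def by (subst mult.commute)
qed

lemma smooth_on_flat_exp: "smooth_on UNIV (flat_exp n)"
proof -
  have "Ck_on k UNIV (flat_exp n)" for k
  proof (induction k arbitrary: n)
    case 0
    show ?case
      using has_derivative_continuous[OF flat_exp_has_derivative]
      by (simp add: continuous_at_imp_continuous_on)
  next
    case (Suc k)
    have "Ck_on k UNIV (\<lambda>t. v * (flat_exp (n+2) t + (- real n) * flat_exp (n+1) t))" for v :: real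
      by (intro Ck_on_bilinear[OF bounded_bilinear_mult] Ck_on_const Ck_on_add Suc)
    then show ?case
      using flat_exp_has_derivative[of n]
      by (intro Ck_on_SucI[where f' = "\<lambda>t v. v * (flat_exp (n+2) t - real n * flat_exp (n+1) t)"])
         auto
  qed
  then show ?thesis by (simp add: smooth_on_def)
qed

lemma smooth_bump_exists:
  fixes a :: "'a::euclidean_space"
  assumes "r > 0"
  obtains \<phi> :: "'a \<Rightarrow> real" where "smooth_on UNIV \<phi>" "\<phi> a = 1" "\<And>x. x \<notin> cball a r \<Longrightarrow> \<phi> x = 0"
proof
  \<comment> \<open>\<open>?q\<close> is \<open>r\<^sup>2 - |x - a|\<^sup>2\<close>, positive exactly in the open ball of radius \<open>r\<close>.\<close>
  let ?q = "\<lambda>x::'a. r\<^sup>2 + (-1) * ((x + - a) \<bullet> (x + - a))"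
  let ?\<phi> = "\<lambda>x. (1 / flat_exp 0 (r\<^sup>2)) * flat_exp 0 (?q x)"
  have lin: "smooth_on UNIV (\<lambda>x::'a. x)"
    by (rule smooth_on_bounded_linear) (rule bounded_linear_ident)
  have q: "smooth_on UNIV ?q"
    by (intro smooth_on_add smooth_on_mult smooth_on_inner smooth_on_const lin)
  show "smooth_on UNIV ?\<phi>"
    by (intro smooth_on_mult smooth_on_const)
       (rule smooth_on_compose[OF _ _ _ smooth_on_flat_exp q], auto)
  show "?\<phi> a = 1" using assms by (simp add: flat_exp_def)
  fix x :: 'a assume "x \<notin> cball a r"
  then have "r \<le> norm (x - a)" by (simp add: dist_norm norm_minus_commute)
  then have "r\<^sup>2 \<le> (norm (x - a))\<^sup>2" using assms by (intro power_mono) auto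
  then show "?\<phi> x = 0" by (simp add: flat_exp_def dot_square_norm)
qed

section \<open>Symmetry of second derivatives\<close>

lemma has_real_derivative_along_line:
  fixes f :: "'a::euclidean_space \<Rightarrow> real"
  assumes "f differentiable (at (a + s *\<^sub>R v))"
  shows "((\<lambda>s. f (a + s *\<^sub>R v)) has_real_derivative frechet_derivative f (at (a + s *\<^sub>R v)) v) (at s)"
proof -
  let ?D = "frechet_derivative f (at (a + s *\<^sub>R v))"
  have "((\<lambda>s. a + s *\<^sub>R v) has_derivative (\<lambda>t. t *\<^sub>R v)) (at s)"
    by (auto intro!: derivative_eq_intros)
  from has_derivative_compose[OF this assms[unfolded frechet_derivative_works]]
  have "((\<lambda>s. f (a + s *\<^sub>R v)) has_derivative (\<lambda>t. ?D (t *\<^sub>R v))) (at s)" .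
  moreover have "?D (t *\<^sub>R v) = ?D v * t" for t
    using linear_scale[OF linear_frechet_derivative[OF assms]] by simp
  ultimately show ?thesis by (simp add: has_field_derivative_def)
qed

text \<open>
  The second difference of \<open>f\<close> over a small parallelogram equals a mixed second derivative at some
  point of it, by applying the mean value theorem in each direction.
\<close>

lemma second_difference_mvt:
  fixes f :: "'a::euclidean_space \<Rightarrow> real"
  assumes f: "smooth_on S f" and S: "open S" and h: "h > 0"
    and inS: "\<And>s t. 0 \<le> s \<Longrightarrow> s \<le> h \<Longrightarrow> 0 \<le> t \<Longrightarrow> t \<le> h \<Longrightarrow> x + s *\<^sub>R v + t *\<^sub>R w \<in> S"
  shows "\<exists>s t. 0 < s \<and> s < h \<and> 0 < t \<and> t < h \<and>
    f (x + h *\<^sub>R v + h *\<^sub>R w) - f (x + h *\<^sub>R v) - f (x + h *\<^sub>R w) + f x =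
    h * (h * frechet_derivative (\<lambda>y. frechet_derivative f (at y) v) (at (x + s *\<^sub>R v + t *\<^sub>R w)) w)"
proof -
  let ?Dv = "\<lambda>y. frechet_derivative f (at y) v"
  have Dv: "smooth_on S ?Dv" by (rule smooth_on_derivative[OF f S])
  have 1: "((\<lambda>s. f (x + s *\<^sub>R v + t *\<^sub>R w)) has_real_derivative ?Dv (x + s *\<^sub>R v + t *\<^sub>R w)) (at s)"
    if "0 \<le> s" "s \<le> h" "0 \<le> t" "t \<le> h" for s t
    using has_real_derivative_along_line[of f "x + t *\<^sub>R w" s v]
      smooth_on_differentiable[OF f S inS[OF that]] by (simp add: algebra_simps)
  have "((\<lambda>s. f (x + s *\<^sub>R v + h *\<^sub>R w) - f (x + s *\<^sub>R v)) has_real_derivative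
      ?Dv (x + s *\<^sub>R v + h *\<^sub>R w) - ?Dv (x + s *\<^sub>R v)) (at s)" if "0 \<le> s" "s \<le> h" for s
    using DERIV_diff[OF 1[OF that, of h] 1[OF that, of 0]] h by simp
  from MVT2[OF h this] obtain s where s: "0 < s" "s < h" and eq1:
    "f (x + h *\<^sub>R v + h *\<^sub>R w) - f (x + h *\<^sub>R v) - (f (x + h *\<^sub>R w) - f x) =
     h * (?Dv (x + s *\<^sub>R v + h *\<^sub>R w) - ?Dv (x + s *\<^sub>R v))" by auto
  have "((\<lambda>t. ?Dv (x + s *\<^sub>R v + t *\<^sub>R w)) has_real_derivative
      frechet_derivative ?Dv (at (x + s *\<^sub>R v + t *\<^sub>R w)) w) (at t)" if "0 \<le> t" "t \<le> h" for t
    using s that by (intro has_real_derivative_along_line smooth_on_differentiable[OF Dv S] inS) auto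
  from MVT2[OF h this] obtain t where "0 < t" "t < h"
    "?Dv (x + s *\<^sub>R v + h *\<^sub>R w) - ?Dv (x + s *\<^sub>R v) =
     h * frechet_derivative ?Dv (at (x + s *\<^sub>R v + t *\<^sub>R w)) w" by auto
  with s eq1 show ?thesis by (intro exI[of _ s] exI[of _ t]) auto
qed

text \<open>
  The second difference is symmetric in \<open>v\<close> and \<open>w\<close>, so both mixed derivatives take a common value
  arbitrarily close to \<open>x\<close>, and they are continuous.
\<close>

lemma second_derivative_symmetric:
  fixes f :: "'a::euclidean_space \<Rightarrow> real"
  assumes f: "smooth_on S f" and S: "open S" and x: "x \<in> S"
  shows "frechet_derivative (\<lambda>y. frechet_derivative f (at y) v) (at x) w =
         frechet_derivative (\<lambda>y. frechet_derivative f (at y) w) (at x) v"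
proof -
  let ?D = "\<lambda>v w y. frechet_derivative (\<lambda>y. frechet_derivative f (at y) v) (at y) w"
  have near: "\<exists>r>0. \<forall>y\<in>ball x r. dist (?D v w y) (?D v w x) < e" if "e > 0" for v w e
  proof -
    have "isCont (?D v w) x"
      using smooth_on_continuous[OF smooth_on_derivative[OF smooth_on_derivative[OF f S] S]] S x
      by (simp add: continuous_on_eq_continuous_at)
    then show ?thesis using that unfolding continuous_at_eps_delta
      by (metis dist_commute mem_ball)
  qed
  have "\<bar>?D v w x - ?D w v x\<bar> < e" if e: "e > 0" for e
  proof -
    obtain r0 where r0: "r0 > 0" "ball x r0 \<subseteq> S" using S x open_contains_ball by blast
    obtain r1 where r1: "r1 > 0" "\<forall>y\<in>ball x r1. dist (?D v w y) (?D v w x) < e / 2"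
      using near[of "e/2" v w] e by auto
    obtain r2 where r2: "r2 > 0" "\<forall>y\<in>ball x r2. dist (?D w v y) (?D w v x) < e / 2"
      using near[of "e/2" w v] e by auto
    define r where "r = min r0 (min r1 r2)"
    define h where "h = r / (norm v + norm w + 1)"
    have r: "r > 0" using r0 r1 r2 by (simp add: r_def)
    have n: "norm v + norm w + 1 > 0" by (smt (verit) norm_ge_zero)
    have h: "h > 0" using r n by (simp add: h_def)
    have in_ball: "x + s *\<^sub>R v + t *\<^sub>R w \<in> ball x r" if "0 \<le> s" "s \<le> h" "0 \<le> t" "t \<le> h" for s t
    proof -
      have "norm (s *\<^sub>R v + t *\<^sub>R w) \<le> s * norm v + t * norm w"
        using norm_triangle_ineq[of "s *\<^sub>R v" "t *\<^sub>R w"] that by simp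
      also have "\<dots> \<le> h * norm v + h * norm w"
        using that by (intro add_mono mult_right_mono) auto
      also have "\<dots> < h * (norm v + norm w + 1)" using h by (simp add: algebra_simps)
      also have "\<dots> = r" using n by (simp add: h_def)
      finally show ?thesis
        using norm_minus_cancel[of "s *\<^sub>R v + t *\<^sub>R w"] by (simp add: dist_norm algebra_simps)
    qed
    have inS: "x + s *\<^sub>R v + t *\<^sub>R w \<in> S" if "0 \<le> s" "s \<le> h" "0 \<le> t" "t \<le> h" for s t
      using in_ball[OF that] r0 by (auto simp: r_def)
    obtain s t where st: "0 < s" "s < h" "0 < t" "t < h" and eq1:
      "f (x + h *\<^sub>R v + h *\<^sub>R w) - f (x + h *\<^sub>R v) - f (x + h *\<^sub>R w) + f x =
       h * (h * ?D v w (x + s *\<^sub>R v + t *\<^sub>R w))"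
      using second_difference_mvt[OF f S h inS] by blast
    have inS': "x + s *\<^sub>R w + t *\<^sub>R v \<in> S" if "0 \<le> s" "s \<le> h" "0 \<le> t" "t \<le> h" for s t
      using inS[of t s] that by (simp add: algebra_simps)
    obtain s' t' where st': "0 < s'" "s' < h" "0 < t'" "t' < h" and eq2:
      "f (x + h *\<^sub>R w + h *\<^sub>R v) - f (x + h *\<^sub>R w) - f (x + h *\<^sub>R v) + f x =
       h * (h * ?D w v (x + s' *\<^sub>R w + t' *\<^sub>R v))"
      using second_difference_mvt[OF f S h inS'] by blast
    have "f (x + h *\<^sub>R w + h *\<^sub>R v) = f (x + h *\<^sub>R v + h *\<^sub>R w)" by (simp add: algebra_simps)
    with eq1 eq2 have "h * (h * ?D v w (x + s *\<^sub>R v + t *\<^sub>R w)) = h * (h * ?D w v (x + s' *\<^sub>R w + t' *\<^sub>R v))"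
      by linarith
    then have eq: "?D v w (x + s *\<^sub>R v + t *\<^sub>R w) = ?D w v (x + t' *\<^sub>R v + s' *\<^sub>R w)"
      using h by (simp add: algebra_simps)
    have "dist (?D v w (x + s *\<^sub>R v + t *\<^sub>R w)) (?D v w x) < e / 2"
      using r1(2) in_ball[of s t] st by (auto simp: r_def)
    moreover have "dist (?D w v (x + t' *\<^sub>R v + s' *\<^sub>R w)) (?D w v x) < e / 2"
      using r2(2) in_ball[of t' s'] st' by (auto simp: r_def)
    ultimately show ?thesis using eq unfolding dist_real_def by linarith
  qed
  then have "\<not> \<bar>?D v w x - ?D w v x\<bar> > 0" by blast
  then show ?thesis by simp
qed

section \<open>Charts and tangent vectors\<close>

text \<open>
  A manifold with its atlas, so that the facts about charts, fields and derivations need not repeat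
  the hypothesis \<open>smooth_atlas A\<close>.
\<close>

locale smooth_manifold =
  fixes A :: "('m::{t2_space,second_countable_topology}, 'e::euclidean_space) chart set"
  assumes smooth_atlas: "smooth_atlas A"
begin

lemma chart_homeo:
  assumes "c \<in> A"
  shows "open (fst c)" "open (chart_image c)"
    "homeomorphism (fst c) (chart_image c) (snd c) (chart_inv c)"
  using smooth_atlas assms unfolding smooth_atlas_def by blast+

lemma chart_inv_chart: "c \<in> A \<Longrightarrow> q \<in> fst c \<Longrightarrow> chart_inv c (snd c q) = q"
  using chart_homeo(3) by (auto simp: homeomorphism_def)

lemma chart_chart_inv: "c \<in> A \<Longrightarrow> u \<in> chart_image c \<Longrightarrow> snd c (chart_inv c u) = u"
  using chart_homeo(3) by (auto simp: homeomorphism_def)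

lemma chart_inv_in: "u \<in> chart_image c \<Longrightarrow> chart_inv c u \<in> fst c"
  by (simp add: inv_into_into)

lemma image_chart_inv_subset: "K \<subseteq> chart_image c \<Longrightarrow> chart_inv c ` K \<subseteq> fst c"
  by (rule image_subsetI, rule chart_inv_in, erule (1) subsetD)

lemma open_chart_image_Int:
  assumes "c \<in> A" "open T"
  shows "open (snd c ` (fst c \<inter> T))"
proof -
  have "snd c ` (fst c \<inter> T) = chart_image c \<inter> chart_inv c -` T"
    using chart_inv_chart[OF assms(1)] by (force simp: image_iff)
  moreover have "continuous_on (chart_image c) (chart_inv c)"
    using chart_homeo(3)[OF assms(1)] by (simp add: homeomorphism_def)
  ultimately show ?thesis
    using continuous_open_preimage chart_homeo(2)[OF assms(1)] assms(2) by metis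
qed

lemma open_overlap: "c \<in> A \<Longrightarrow> d \<in> A \<Longrightarrow> open (snd c ` (fst c \<inter> fst d))"
  by (simp add: open_chart_image_Int chart_homeo(1))

lemma smooth_transition:
  "c \<in> A \<Longrightarrow> d \<in> A \<Longrightarrow> smooth_on (snd c ` (fst c \<inter> fst d)) (snd d \<circ> chart_inv c)"
  using smooth_atlas unfolding smooth_atlas_def by blast

lemma chart_at: "chart_at A p \<in> A" "p \<in> fst (chart_at A p)"
proof -
  have "\<exists>c. c \<in> A \<and> p \<in> fst c" using smooth_atlas unfolding smooth_atlas_def by blast
  then have "chart_at A p \<in> A \<and> p \<in> fst (chart_at A p)" unfolding chart_at_def by (rule someI_ex)
  then show "chart_at A p \<in> A" "p \<in> fst (chart_at A p)" by auto
qed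

text \<open>
  The derivative at the point \<open>q\<close> of the transition map from the chart \<open>c\<close> to the chart \<open>d\<close>; it
  turns the components of a tangent vector in \<open>c\<close> into its components in \<open>d\<close>.
\<close>

definition transition_deriv :: "('m, 'e) chart \<Rightarrow> ('m, 'e) chart \<Rightarrow> 'm \<Rightarrow> 'e \<Rightarrow> 'e" where
  "transition_deriv c d q = frechet_derivative (snd d \<circ> chart_inv c) (at (snd c q))"

lemma components_eq: "components A c p v = transition_deriv (chart_at A p) c p v"
  by (simp add: components_def transition_deriv_def)

lemma transition_has_derivative:
  assumes "c \<in> A" "d \<in> A" "q \<in> fst c" "q \<in> fst d"
  shows "((snd d \<circ> chart_inv c) has_derivative transition_deriv c d q) (at (snd c q))"
proof -
  have "(snd d \<circ> chart_inv c) differentiable (at (snd c q))"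
    using assms by (intro smooth_on_differentiable[OF smooth_transition open_overlap]) auto
  then show ?thesis by (simp add: transition_deriv_def frechet_derivative_works)
qed

lemma linear_transition_deriv:
  "c \<in> A \<Longrightarrow> d \<in> A \<Longrightarrow> q \<in> fst c \<Longrightarrow> q \<in> fst d \<Longrightarrow> linear (transition_deriv c d q)"
  using transition_has_derivative has_derivative_linear by blast

lemma transition_deriv_id:
  assumes "c \<in> A" "q \<in> fst c"
  shows "transition_deriv c c q v = v"
proof -
  have "((\<lambda>x. x) has_derivative (\<lambda>x. x)) (at (snd c q))" by (rule has_derivative_ident)
  then have "((snd c \<circ> chart_inv c) has_derivative (\<lambda>x. x)) (at (snd c q))"
    by (rule has_derivative_transform_within_open[OF _ chart_homeo(2)[OF assms(1)]])
       (use assms chart_chart_inv in auto)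
  then have "transition_deriv c c q = (\<lambda>x. x)"
    using transition_has_derivative[OF assms(1) assms(1) assms(2) assms(2)]
    by (rule has_derivative_unique[rotated])
  then show ?thesis by simp
qed

lemma compose_chart_inv_has_derivative:
  assumes cd: "c \<in> A" "d \<in> A" "q \<in> fst c" "q \<in> fst d"
    and f: "((f \<circ> chart_inv d) has_derivative f') (at (snd d q))"
  shows "((f \<circ> chart_inv c) has_derivative (\<lambda>v. f' (transition_deriv c d q v))) (at (snd c q))"
proof -
  have q: "(snd d \<circ> chart_inv c) (snd c q) = snd d q" using chart_inv_chart cd by simp
  have "((f \<circ> chart_inv d \<circ> (snd d \<circ> chart_inv c)) has_derivative (f' \<circ> transition_deriv c d q)) (at (snd c q))"
    by (rule diff_chain_at[OF transition_has_derivative[OF cd]]) (simp only: q f)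
  then show ?thesis
    unfolding o_def
    by (rule has_derivative_transform_within_open[OF _ open_overlap[OF cd(1,2)]])
       (use cd chart_inv_chart in auto)
qed

lemma transition_deriv_compose:
  assumes "c \<in> A" "d \<in> A" "k \<in> A" "q \<in> fst c" "q \<in> fst d" "q \<in> fst k"
  shows "transition_deriv d k q (transition_deriv c d q v) = transition_deriv c k q v"
proof -
  have "((snd k \<circ> chart_inv c) has_derivative (\<lambda>v. transition_deriv d k q (transition_deriv c d q v))) (at (snd c q))"
    using assms by (intro compose_chart_inv_has_derivative transition_has_derivative)
  with transition_has_derivative[of c k q] assms show ?thesis
    by (metis has_derivative_unique)
qed

lemma smooth_on_transition_deriv:
  assumes "c \<in> A" "d \<in> A" "smooth_on (snd c ` (fst c \<inter> fst d)) G"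
  shows "smooth_on (snd c ` (fst c \<inter> fst d)) (\<lambda>u. transition_deriv c d (chart_inv c u) (G u))"
proof (rule smooth_on_cong[OF open_overlap[OF assms(1,2)]])
  show "smooth_on (snd c ` (fst c \<inter> fst d)) (\<lambda>u. frechet_derivative (snd d \<circ> chart_inv c) (at u) (G u))"
    by (rule smooth_on_derivative_along[OF smooth_transition[OF assms(1,2)] open_overlap[OF assms(1,2)] assms(3)])
  fix u assume "u \<in> snd c ` (fst c \<inter> fst d)"
  then have "snd c (chart_inv c u) = u" using assms(1) chart_chart_inv by blast
  then show "frechet_derivative (snd d \<circ> chart_inv c) (at u) (G u) = transition_deriv c d (chart_inv c u) (G u)"
    by (simp add: transition_deriv_def)
qed

lemma smooth_on_change_chart:
  fixes G :: "'e \<Rightarrow> 'b::real_normed_vector"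
  assumes "c \<in> A" "d \<in> A" "smooth_on (chart_image d) G"
  shows "smooth_on (snd c ` (fst c \<inter> fst d)) (\<lambda>u. G (snd d (chart_inv c u)))"
proof (rule smooth_on_compose[OF open_overlap chart_homeo(2) _ assms(3)])
  show "smooth_on (snd c ` (fst c \<inter> fst d)) (\<lambda>u. snd d (chart_inv c u))"
    using smooth_transition[OF assms(1,2)] by (simp add: o_def)
  show "(\<lambda>u. snd d (chart_inv c u)) ` snd c ` (fst c \<inter> fst d) \<subseteq> chart_image d"
    using assms(1) chart_inv_chart by auto
qed (use assms in auto)

lemma local_field_eq: "c \<in> A \<Longrightarrow> q \<in> fst c \<Longrightarrow>
    local_field A c X (snd c q) = transition_deriv (chart_at A q) c q (X q)"
  by (simp add: local_field_def components_eq chart_inv_chart)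

lemma local_field_chart_at: "local_field A (chart_at A p) X (snd (chart_at A p) p) = X p"
  using chart_at by (simp add: local_field_eq transition_deriv_id)

lemma field_eq_local_field:
  "c \<in> A \<Longrightarrow> q \<in> fst c \<Longrightarrow> X q = transition_deriv c (chart_at A q) q (local_field A c X (snd c q))"
  using chart_at by (simp add: local_field_eq transition_deriv_compose transition_deriv_id)

lemma smooth_on_local_field: "vector_field A X \<Longrightarrow> c \<in> A \<Longrightarrow> smooth_on (chart_image c) (local_field A c X)"
  by (simp add: vector_field_def)

lemma smooth_fun_const: "smooth_fun A (\<lambda>p. k)"
  by (simp add: smooth_fun_def o_def smooth_on_const)

lemma smooth_fun_mult: "smooth_fun A f \<Longrightarrow> smooth_fun A h \<Longrightarrow> smooth_fun A (\<lambda>p. f p * h p)"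
  by (simp add: smooth_fun_def o_def smooth_on_mult)

lemma vector_field_add:
  assumes "vector_field A X" "vector_field A Y"
  shows "vector_field A (\<lambda>p. X p + Y p)"
  unfolding vector_field_def
proof
  fix c assume c: "c \<in> A"
  show "smooth_on (chart_image c) (local_field A c (\<lambda>p. X p + Y p))"
  proof (rule smooth_on_cong[OF chart_homeo(2)[OF c] _ smooth_on_add[OF assms[THEN smooth_on_local_field, OF c]]])
    fix u assume "u \<in> chart_image c"
    then show "local_field A c X u + local_field A c Y u = local_field A c (\<lambda>p. X p + Y p) u"
      using c chart_at by (auto simp: local_field_eq linear_add[OF linear_transition_deriv])
  qed
qed

lemma vector_field_scaleR:
  assumes "smooth_fun A f" "vector_field A X"
  shows "vector_field A (\<lambda>p. f p *\<^sub>R X p)"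
  unfolding vector_field_def
proof
  fix c assume c: "c \<in> A"
  have "smooth_on (chart_image c) (f \<circ> chart_inv c)"
    using assms(1) c by (simp add: smooth_fun_def)
  from smooth_on_scaleR[OF this smooth_on_local_field[OF assms(2) c]]
  show "smooth_on (chart_image c) (local_field A c (\<lambda>p. f p *\<^sub>R X p))"
  proof (rule smooth_on_cong[OF chart_homeo(2)[OF c], rotated])
    fix u assume "u \<in> chart_image c"
    then show "(f \<circ> chart_inv c) u *\<^sub>R local_field A c X u = local_field A c (\<lambda>p. f p *\<^sub>R X p) u"
      using c chart_at by (auto simp: local_field_eq linear_scale[OF linear_transition_deriv] chart_inv_chart)
  qed
qed

lemma vector_field_cmult: "vector_field A X \<Longrightarrow> vector_field A (\<lambda>p. k *\<^sub>R X p)"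
  using vector_field_scaleR[OF smooth_fun_const] .

lemma vector_field_zero: "vector_field A (\<lambda>p. 0)"
  unfolding vector_field_def
proof
  fix c assume c: "c \<in> A"
  show "smooth_on (chart_image c) (local_field A c (\<lambda>p. 0))"
  proof (rule smooth_on_cong[OF chart_homeo(2)[OF c] _ smooth_on_const])
    fix u assume "u \<in> chart_image c"
    then show "0 = local_field A c (\<lambda>p. 0) u"
      using c chart_at by (auto simp: local_field_eq linear_0[OF linear_transition_deriv])
  qed
qed

lemma vector_field_sum:
  "(\<And>i. i \<in> I \<Longrightarrow> vector_field A (X i)) \<Longrightarrow> vector_field A (\<lambda>p. \<Sum>i\<in>I. X i p)"
  by (induction I rule: infinite_finite_induct) (auto simp: vector_field_zero vector_field_add)

section \<open>Extension of functions and fields from a chart\<close>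

text \<open>
  The support of a function transported from a chart is compact, hence closed, because the manifold
  is Hausdorff. This is what makes the extension by zero smooth.
\<close>

lemma chart_complement_support:
  assumes c: "c \<in> A" and K: "compact K" "K \<subseteq> chart_image c"
  shows "open (- (chart_inv c ` K))"
proof -
  have "continuous_on K (chart_inv c)"
    using chart_homeo(3)[OF c] K(2) by (auto simp: homeomorphism_def intro: continuous_on_subset)
  then show ?thesis using K(1) by (simp add: compact_continuous_image compact_imp_closed open_Compl)
qed

text \<open>
  Near a point of the domain of \<open>c\<close> the function is read in \<open>c\<close>; near any other point it vanishes.
\<close>

lemma smooth_fun_extend_zero:
  assumes c: "c \<in> A" and G: "smooth_on (chart_image c) G"
    and K: "compact K" "K \<subseteq> chart_image c" "\<And>u. u \<notin> K \<Longrightarrow> G u = 0"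
  shows "smooth_fun A (\<lambda>q. if q \<in> fst c then G (snd c q) else 0)" (is "smooth_fun A ?f")
  unfolding smooth_fun_def
proof
  fix d assume d: "d \<in> A"
  show "smooth_on (chart_image d) (?f \<circ> chart_inv d)"
  proof (rule smooth_on_local[OF chart_homeo(2)[OF d]])
    fix u assume u: "u \<in> chart_image d"
    let ?q = "chart_inv d u"
    show "\<exists>U. open U \<and> u \<in> U \<and> smooth_on U (?f \<circ> chart_inv d)"
    proof (cases "?q \<in> fst c")
      case True
      let ?U = "snd d ` (fst d \<inter> fst c)"
      have "smooth_on ?U (?f \<circ> chart_inv d)"
        by (rule smooth_on_cong[OF open_overlap[OF d c] _ smooth_on_change_chart[OF d c G]])
           (use d chart_inv_chart in auto)
      moreover have "u \<in> ?U" using True u chart_chart_inv[OF d u] chart_inv_in[OF u]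
        by (intro image_eqI[of _ _ ?q]) auto
      ultimately show ?thesis using open_overlap[OF d c] by blast
    next
      case False
      let ?U = "snd d ` (fst d \<inter> - (chart_inv c ` K))"
      have op: "open ?U" by (rule open_chart_image_Int[OF d chart_complement_support[OF c K(1,2)]])
      have "?q \<notin> chart_inv c ` K" using False image_chart_inv_subset[OF K(2)] by blast
      then have "u \<in> ?U" using u chart_chart_inv[OF d u] chart_inv_in[OF u]
        by (intro image_eqI[of _ _ ?q]) auto
      moreover have "smooth_on ?U (?f \<circ> chart_inv d)"
      proof (rule smooth_on_cong[OF op _ smooth_on_const])
        fix y assume "y \<in> ?U"
        then obtain q where q: "q \<in> fst d" "q \<notin> chart_inv c ` K" "y = snd d q" by blast
        then have "q \<in> fst c \<Longrightarrow> snd c q \<notin> K" using chart_inv_chart[OF c] by force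
        then show "0 = (?f \<circ> chart_inv d) y" using q K(3) chart_inv_chart[OF d] by auto
      qed
      ultimately show ?thesis using op by blast
    qed
  qed
qed

text \<open>
  The vector field with components \<open>G\<close> in the chart \<open>c\<close>, extended by zero. Since tangent vectors at
  \<open>q\<close> are given by components in \<open>chart_at A q\<close>, the value \<open>G\<close> is moved to that chart.
\<close>

definition chart_field :: "('m, 'e) chart \<Rightarrow> ('e \<Rightarrow> 'e) \<Rightarrow> 'm \<Rightarrow> 'e" where
  "chart_field c G q = (if q \<in> fst c then transition_deriv c (chart_at A q) q (G (snd c q)) else 0)"

lemma local_field_chart_field:
  assumes "c \<in> A" "d \<in> A" "q \<in> fst d"
  shows "local_field A d (chart_field c G) (snd d q) =
    (if q \<in> fst c then transition_deriv c d q (G (snd c q)) else 0)"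
  using assms chart_at
  by (auto simp: local_field_eq chart_field_def transition_deriv_compose linear_0[OF linear_transition_deriv])

lemma vector_field_chart_field:
  assumes c: "c \<in> A" and G: "smooth_on (chart_image c) G"
    and K: "compact K" "K \<subseteq> chart_image c" "\<And>u. u \<notin> K \<Longrightarrow> G u = 0"
  shows "vector_field A (chart_field c G)"
  unfolding vector_field_def
proof
  fix d assume d: "d \<in> A"
  let ?F = "local_field A d (chart_field c G)"
  show "smooth_on (chart_image d) ?F"
  proof (rule smooth_on_local[OF chart_homeo(2)[OF d]])
    fix u assume u: "u \<in> chart_image d"
    let ?q = "chart_inv d u"
    show "\<exists>U. open U \<and> u \<in> U \<and> smooth_on U ?F"
    proof (cases "?q \<in> fst c")
      case True
      let ?U = "snd d ` (fst d \<inter> fst c)"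
      let ?V = "snd c ` (fst c \<inter> fst d)"
      have "smooth_on ?V G" by (rule smooth_on_subset[OF G]) auto
      from smooth_on_transition_deriv[OF c d this]
      have "smooth_on ?V (\<lambda>y. transition_deriv c d (chart_inv c y) (G y))" .
      moreover have "smooth_on ?U (snd c \<circ> chart_inv d)" by (rule smooth_transition[OF d c])
      moreover have "(snd c \<circ> chart_inv d) ` ?U \<subseteq> ?V" using d chart_inv_chart by auto
      ultimately have "smooth_on ?U (\<lambda>y. transition_deriv c d (chart_inv c ((snd c \<circ> chart_inv d) y)) (G ((snd c \<circ> chart_inv d) y)))"
        using smooth_on_compose[OF open_overlap[OF d c] open_overlap[OF c d]] by blast
      then have "smooth_on ?U ?F"
      proof (rule smooth_on_cong[OF open_overlap[OF d c], rotated])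
        fix y assume "y \<in> ?U"
        then obtain q where q: "q \<in> fst d" "q \<in> fst c" "y = snd d q" by blast
        then show "transition_deriv c d (chart_inv c ((snd c \<circ> chart_inv d) y)) (G ((snd c \<circ> chart_inv d) y)) = ?F y"
          using local_field_chart_field[OF c d q(1)] by (simp add: chart_inv_chart c d)
      qed
      moreover have "u \<in> ?U" using True u chart_chart_inv[OF d u] chart_inv_in[OF u]
        by (intro image_eqI[of _ _ ?q]) auto
      ultimately show ?thesis using open_overlap[OF d c] by blast
    next
      case False
      let ?U = "snd d ` (fst d \<inter> - (chart_inv c ` K))"
      have op: "open ?U" by (rule open_chart_image_Int[OF d chart_complement_support[OF c K(1,2)]])
      have "?q \<notin> chart_inv c ` K" using False image_chart_inv_subset[OF K(2)] by blast
      then have "u \<in> ?U" using u chart_chart_inv[OF d u] chart_inv_in[OF u]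
        by (intro image_eqI[of _ _ ?q]) auto
      moreover have "smooth_on ?U ?F"
      proof (rule smooth_on_cong[OF op _ smooth_on_const])
        fix y assume "y \<in> ?U"
        then obtain q where q: "q \<in> fst d" "q \<notin> chart_inv c ` K" "y = snd d q" by blast
        then have "q \<in> fst c \<Longrightarrow> snd c q \<notin> K" using chart_inv_chart[OF c] by force
        then show "0 = ?F y"
          using q K(3) c d by (auto simp: local_field_chart_field linear_0[OF linear_transition_deriv])
      qed
      ultimately show ?thesis using op by blast
    qed
  qed
qed

lemma chart_bump_exists:
  assumes "c \<in> A" "p \<in> fst c"
  obtains \<phi> K where "smooth_on (chart_image c) \<phi>" "compact K" "K \<subseteq> chart_image c"
    "\<phi> (snd c p) = (1::real)" "\<And>u. u \<notin> K \<Longrightarrow> \<phi> u = 0"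
proof -
  obtain r where r: "r > 0" "cball (snd c p) r \<subseteq> chart_image c"
    using chart_homeo(2)[OF assms(1)] assms(2) open_contains_cball by blast
  obtain \<phi> :: "'e \<Rightarrow> real" where "smooth_on UNIV \<phi>" "\<phi> (snd c p) = 1" "\<And>u. u \<notin> cball (snd c p) r \<Longrightarrow> \<phi> u = 0"
    using smooth_bump_exists[OF r(1)] by blast
  then show thesis using r that[of \<phi> "cball (snd c p) r"] smooth_on_subset[of UNIV \<phi>] by auto
qed

lemma vector_field_extension: "\<exists>X. vector_field A X \<and> X p = v"
proof -
  let ?c = "chart_at A p"
  obtain \<phi> K where \<phi>: "smooth_on (chart_image ?c) \<phi>" "compact K" "K \<subseteq> chart_image ?c"
    "\<phi> (snd ?c p) = (1::real)" "\<And>u. u \<notin> K \<Longrightarrow> \<phi> u = 0"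
    by (rule chart_bump_exists[OF chart_at]) blast
  have "vector_field A (chart_field ?c (\<lambda>u. \<phi> u *\<^sub>R v))"
    using \<phi> by (intro vector_field_chart_field chart_at smooth_on_scaleR smooth_on_const) auto
  moreover have "chart_field ?c (\<lambda>u. \<phi> u *\<^sub>R v) p = v"
    using chart_at \<phi>(4) by (simp add: chart_field_def transition_deriv_id)
  ultimately show ?thesis by blast
qed

lemma extend: "vector_field A (extend A p v)" "extend A p v p = v"
proof -
  have "vector_field A (extend A p v) \<and> extend A p v p = v"
    unfolding extend_def by (rule someI_ex[OF vector_field_extension])
  then show "vector_field A (extend A p v)" "extend A p v p = v" by auto
qed

section \<open>Tensoriality\<close>

text \<open>
  If \<open>Z\<close> vanishes at \<open>p\<close> and \<open>\<psi>\<close> is a bump function at \<open>p\<close> supported in a chart, then \<open>\<psi>\<^sup>2 Z\<close> is a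
  combination of globally defined fields \<open>E b\<close> whose coefficients are smooth functions vanishing at
  \<open>p\<close>.
\<close>

lemma tensorial_zero:
  fixes T :: "('m \<Rightarrow> 'e) \<Rightarrow> 'b::real_vector"
  assumes add: "\<And>Y Z. vector_field A Y \<Longrightarrow> vector_field A Z \<Longrightarrow> T (\<lambda>q. Y q + Z q) = T Y + T Z"
    and scale: "\<And>f Z. smooth_fun A f \<Longrightarrow> vector_field A Z \<Longrightarrow> T (\<lambda>q. f q *\<^sub>R Z q) = f p *\<^sub>R T Z"
    and Z: "vector_field A Z" "Z p = 0"
  shows "T Z = 0"
proof -
  define c where "c = chart_at A p"
  have c: "c \<in> A" "p \<in> fst c" using chart_at by (auto simp: c_def)
  obtain \<phi> K where \<phi>: "smooth_on (chart_image c) \<phi>" "compact K" "K \<subseteq> chart_image c"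
    "\<phi> (snd c p) = (1::real)" "\<And>u. u \<notin> K \<Longrightarrow> \<phi> u = 0"
    by (rule chart_bump_exists[OF c]) blast
  define \<psi> where "\<psi> = (\<lambda>q. if q \<in> fst c then \<phi> (snd c q) else 0)"
  define z where "z = (\<lambda>b q. if q \<in> fst c then \<phi> (snd c q) * (local_field A c Z (snd c q) \<bullet> b) else 0)"
  define E where "E = (\<lambda>b. chart_field c (\<lambda>u. \<phi> u *\<^sub>R b))"
  have \<psi>: "smooth_fun A \<psi>" unfolding \<psi>_def
    by (rule smooth_fun_extend_zero[OF c(1) \<phi>(1,2,3,5)])
  have z: "smooth_fun A (z b)" for b unfolding z_def
    by (rule smooth_fun_extend_zero[OF c(1) _ \<phi>(2,3), where G = "\<lambda>u. \<phi> u * (local_field A c Z u \<bullet> b)"])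
       (auto intro!: smooth_on_mult smooth_on_inner smooth_on_const smooth_on_local_field \<phi> c Z)
  have E: "vector_field A (E b)" for b unfolding E_def
    by (rule vector_field_chart_field[OF c(1) _ \<phi>(2,3)])
       (auto intro!: smooth_on_scaleR smooth_on_const \<phi>)
  have zE: "(\<Sum>b\<in>Basis. z b q *\<^sub>R E b q) = (\<psi> q * \<psi> q) *\<^sub>R Z q" for q
  proof (cases "q \<in> fst c")
    case True
    have lin: "linear (transition_deriv c (chart_at A q) q)"
      using linear_transition_deriv c chart_at True by blast
    have "(\<Sum>b\<in>Basis. z b q *\<^sub>R E b q) = (\<psi> q * \<psi> q) *\<^sub>R transition_deriv c (chart_at A q) q
        (\<Sum>b\<in>Basis. (local_field A c Z (snd c q) \<bullet> b) *\<^sub>R b)"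
      using True by (simp add: z_def E_def \<psi>_def chart_field_def linear_sum[OF lin] linear_scale[OF lin]
          scaleR_sum_right mult_ac)
    then show ?thesis
      using field_eq_local_field[OF c(1) True, of Z] by (simp add: euclidean_representation)
  qed (simp add: z_def \<psi>_def)
  have T0: "T (\<lambda>q. 0) = 0" using scale[OF smooth_fun_const vector_field_zero, of 0] by simp
  have Tsum: "T (\<lambda>q. \<Sum>b\<in>I. X b q) = (\<Sum>b\<in>I. T (X b))" if "finite I" "\<And>b. vector_field A (X b)" for X I
    using that(1)
    by (induction I rule: finite_induct) (simp_all add: T0 add that(2) vector_field_sum)
  have "T (\<lambda>q. (\<psi> q * \<psi> q) *\<^sub>R Z q) = T (\<lambda>q. \<Sum>b\<in>Basis. z b q *\<^sub>R E b q)" by (simp add: zE)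
  also have "\<dots> = (\<Sum>b\<in>Basis. z b p *\<^sub>R T (E b))"
    by (simp add: Tsum vector_field_scaleR z E scale)
  also have "\<dots> = 0"
    using c Z(2) chart_at by (simp add: z_def local_field_eq linear_0[OF linear_transition_deriv])
  finally have "(\<psi> p * \<psi> p) *\<^sub>R T Z = 0" using scale[OF smooth_fun_mult[OF \<psi> \<psi>] Z(1)] by simp
  then show ?thesis using \<phi>(4) c by (simp add: \<psi>_def)
qed

lemma tensorial_cong:
  fixes T :: "('m \<Rightarrow> 'e) \<Rightarrow> 'b::real_vector"
  assumes add: "\<And>Y Z. vector_field A Y \<Longrightarrow> vector_field A Z \<Longrightarrow> T (\<lambda>q. Y q + Z q) = T Y + T Z"
    and scale: "\<And>f Z. smooth_fun A f \<Longrightarrow> vector_field A Z \<Longrightarrow> T (\<lambda>q. f q *\<^sub>R Z q) = f p *\<^sub>R T Z"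
    and YZ: "vector_field A Y" "vector_field A Z" "Y p = Z p"
  shows "T Y = T Z"
proof -
  have m: "vector_field A (\<lambda>q. (-1) *\<^sub>R Z q)" by (rule vector_field_cmult[OF YZ(2)])
  have "T (\<lambda>q. Y q + (-1) *\<^sub>R Z q) = 0"
    using vector_field_add[OF YZ(1) m] by (intro tensorial_zero[where p = p and T = T] add scale) (simp_all add: YZ(3))
  then show ?thesis using add[OF YZ(1) m] scale[OF smooth_fun_const YZ(2), of "-1"] by simp
qed

section \<open>Derivations and the Lie bracket\<close>

text \<open>
  Differentiability at a point, tested in the chart \<open>chart_at A p\<close> used by \<open>deriv_along\<close>. It is
  weaker than \<open>smooth_fun\<close>, and all that is needed of the functions \<open>\<theta>(W)\<close> below.
\<close>

definition differentiable_fun_at :: "('m \<Rightarrow> real) \<Rightarrow> 'm \<Rightarrow> bool" where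
  "differentiable_fun_at f p \<longleftrightarrow>
     (f \<circ> chart_inv (chart_at A p)) differentiable (at (snd (chart_at A p) p))"

lemma smooth_fun_differentiable:
  assumes "smooth_fun A f" "c \<in> A" "p \<in> fst c"
  shows "(f \<circ> chart_inv c) differentiable (at (snd c p))"
  by (rule smooth_on_differentiable[OF _ chart_homeo(2)[OF assms(2)]]) (use assms in \<open>auto simp: smooth_fun_def\<close>)

lemma smooth_fun_imp_differentiable_fun_at: "smooth_fun A f \<Longrightarrow> differentiable_fun_at f p"
  unfolding differentiable_fun_at_def using smooth_fun_differentiable chart_at by blast

lemma deriv_along_eqI:
  "((f \<circ> chart_inv (chart_at A p)) has_derivative f') (at (snd (chart_at A p) p)) \<Longrightarrow>
    deriv_along A X f p = f' (X p)"
  unfolding deriv_along_def by (metis frechet_derivative_at)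

lemma deriv_along_has_derivative:
  "differentiable_fun_at f p \<Longrightarrow>
    ((f \<circ> chart_inv (chart_at A p)) has_derivative
       frechet_derivative (f \<circ> chart_inv (chart_at A p)) (at (snd (chart_at A p) p)))
     (at (snd (chart_at A p) p))"
  by (simp add: differentiable_fun_at_def frechet_derivative_works)

lemma deriv_along_add:
  assumes "differentiable_fun_at f p" "differentiable_fun_at h p"
  shows "deriv_along A X (\<lambda>q. f q + h q) p = deriv_along A X f p + deriv_along A X h p"
    and "differentiable_fun_at (\<lambda>q. f q + h q) p"
  using deriv_along_eqI[of "\<lambda>q. f q + h q" p]
    has_derivative_add[OF assms[THEN deriv_along_has_derivative]]
  by (auto simp: o_def deriv_along_def differentiable_fun_at_def differentiable_def)

lemma deriv_along_mult:
  assumes "differentiable_fun_at f p" "differentiable_fun_at h p"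
  shows "deriv_along A X (\<lambda>q. f q * h q) p = deriv_along A X f p * h p + f p * deriv_along A X h p"
    and "differentiable_fun_at (\<lambda>q. f q * h q) p"
  using deriv_along_eqI[of "\<lambda>q. f q * h q" p]
    has_derivative_mult[OF assms[THEN deriv_along_has_derivative]]
  by (auto simp: o_def deriv_along_def differentiable_fun_at_def differentiable_def chart_inv_chart chart_at)

lemma deriv_along_const: "deriv_along A X (\<lambda>q. k) p = 0"
  by (simp add: deriv_along_def o_def)

lemma deriv_along_cmult:
  assumes "differentiable_fun_at f p"
  shows "deriv_along A X (\<lambda>q. k * f q) p = k * deriv_along A X f p"
    and "differentiable_fun_at (\<lambda>q. k * f q) p"
  using deriv_along_mult[OF smooth_fun_imp_differentiable_fun_at[OF smooth_fun_const, of k] assms]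
  by (auto simp: deriv_along_const)

lemma deriv_along_chart:
  assumes f: "smooth_fun A f" and c: "c \<in> A" "p \<in> fst c"
  shows "deriv_along A X f p = frechet_derivative (f \<circ> chart_inv c) (at (snd c p)) (local_field A c X (snd c p))"
proof -
  have "((f \<circ> chart_inv c) has_derivative frechet_derivative (f \<circ> chart_inv c) (at (snd c p))) (at (snd c p))"
    using smooth_fun_differentiable[OF assms] by (simp add: frechet_derivative_works)
  from deriv_along_eqI[OF compose_chart_inv_has_derivative[OF chart_at(1) c(1) chart_at(2) c(2) this]]
  show ?thesis using c by (simp add: local_field_eq)
qed

lemma smooth_fun_deriv_along:
  assumes "smooth_fun A f" "vector_field A X"
  shows "smooth_fun A (deriv_along A X f)"
  unfolding smooth_fun_def
proof
  fix c assume c: "c \<in> A"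
  have "smooth_on (chart_image c) (\<lambda>u. frechet_derivative (f \<circ> chart_inv c) (at u) (local_field A c X u))"
    using assms c by (intro smooth_on_derivative_along chart_homeo(2) smooth_on_local_field)
      (auto simp: smooth_fun_def)
  then show "smooth_on (chart_image c) (deriv_along A X f \<circ> chart_inv c)"
    by (rule smooth_on_cong[OF chart_homeo(2)[OF c], rotated])
       (use c assms in \<open>auto simp: deriv_along_chart[OF assms(1) c] chart_inv_chart\<close>)
qed

lemma frechet_derivative_along_field:
  fixes f :: "'e \<Rightarrow> real"
  assumes f: "smooth_on S f" and S: "open S" "u \<in> S" and V: "V differentiable (at u)"
  shows "frechet_derivative (\<lambda>y. frechet_derivative f (at y) (V y)) (at u) w =
    frechet_derivative (\<lambda>y. frechet_derivative f (at y) (V u)) (at u) w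
    + frechet_derivative f (at u) (frechet_derivative V (at u) w)"
proof -
  let ?D = "\<lambda>b y. frechet_derivative f (at y) b"
  have lin: "linear (\<lambda>v. ?D v y)" if "y \<in> S" for y
    using linear_frechet_derivative[OF smooth_on_differentiable[OF f S(1) that]] .
  have exp: "?D v y = (\<Sum>b\<in>Basis. (v \<bullet> b) * ?D b y)" if "y \<in> S" for v y
    by (subst euclidean_representation[of v, symmetric])
       (simp only: linear_sum[OF lin[OF that]] linear_scale[OF lin[OF that]] real_scaleR_def)
  have D: "(?D b has_derivative frechet_derivative (?D b) (at u)) (at u)" for b
    using smooth_on_differentiable[OF smooth_on_derivative[OF f S(1)] S] by (simp add: frechet_derivative_works)
  have V': "(V has_derivative frechet_derivative V (at u)) (at u)" using V by (simp add: frechet_derivative_works)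
  have 1: "((\<lambda>y. \<Sum>b\<in>Basis. (V y \<bullet> b) * ?D b y) has_derivative
      (\<lambda>w. \<Sum>b\<in>Basis. (V u \<bullet> b) * frechet_derivative (?D b) (at u) w + (frechet_derivative V (at u) w \<bullet> b) * ?D b u)) (at u)"
    by (intro has_derivative_sum has_derivative_mult D has_derivative_inner_left V')
  have 2: "((\<lambda>y. \<Sum>b\<in>Basis. (V u \<bullet> b) * ?D b y) has_derivative
      (\<lambda>w. \<Sum>b\<in>Basis. (V u \<bullet> b) * frechet_derivative (?D b) (at u) w)) (at u)"
    by (intro has_derivative_sum has_derivative_mult_right D)
  have "((\<lambda>y. ?D (V y) y) has_derivative
      (\<lambda>w. \<Sum>b\<in>Basis. (V u \<bullet> b) * frechet_derivative (?D b) (at u) w + (frechet_derivative V (at u) w \<bullet> b) * ?D b u)) (at u)"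
    by (rule has_derivative_transform_within_open[OF 1 S]) (simp add: exp)
  moreover have "((\<lambda>y. ?D (V u) y) has_derivative
      (\<lambda>w. \<Sum>b\<in>Basis. (V u \<bullet> b) * frechet_derivative (?D b) (at u) w)) (at u)"
    by (rule has_derivative_transform_within_open[OF 2 S]) (simp add: exp[of _ "V u"])
  ultimately show ?thesis
    by (simp add: frechet_derivative_at[symmetric] sum.distrib exp[OF S(2), of "frechet_derivative V (at u) w"])
qed

text \<open>
  \<open>[X,Y] f = X (Y f) - Y (X f)\<close>. The inner derivative \<open>Y f\<close> is evaluated at points near \<open>p\<close>, each
  with a chart of its own; it is first rewritten in the single chart \<open>chart_at A p\<close>.
\<close>

lemma lie_bracket_deriv:
  assumes f: "smooth_fun A f" and X: "vector_field A X" and Y: "vector_field A Y"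
  shows "deriv_along A (lie_bracket A X Y) f p =
    deriv_along A X (deriv_along A Y f) p - deriv_along A Y (deriv_along A X f) p"
proof -
  define c where "c = chart_at A p"
  define u where "u = snd c p"
  define F where "F = f \<circ> chart_inv c"
  have c: "c \<in> A" "p \<in> fst c" using chart_at by (auto simp: c_def)
  have u: "u \<in> chart_image c" using c by (simp add: u_def)
  have op: "open (chart_image c)" by (rule chart_homeo(2)[OF c(1)])
  have F: "smooth_on (chart_image c) F" using f c by (simp add: F_def smooth_fun_def)
  \<comment> \<open>The first summand is symmetric in the two fields; the second one produces the bracket.\<close>
  have second: "deriv_along A X (deriv_along A Y f) p =
      frechet_derivative (\<lambda>y. frechet_derivative F (at y) (Y p)) (at u) (X p)
      + frechet_derivative F (at u) (frechet_derivative (local_field A c Y) (at u) (X p))"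
    if Y: "vector_field A Y" for X Y
  proof -
    have Yp: "local_field A c Y u = Y p" unfolding u_def c_def by (rule local_field_chart_at)
    have V: "local_field A c Y differentiable (at u)"
      by (rule smooth_on_differentiable[OF smooth_on_local_field[OF Y c(1)] op u])
    let ?G = "\<lambda>y. frechet_derivative F (at y) (local_field A c Y y)"
    have "?G differentiable (at u)"
      by (rule smooth_on_differentiable[OF _ op u])
         (rule smooth_on_derivative_along[OF F op smooth_on_local_field[OF Y c(1)]])
    then have "(?G has_derivative frechet_derivative ?G (at u)) (at u)" by (simp add: frechet_derivative_works)
    then have "((deriv_along A Y f \<circ> chart_inv c) has_derivative frechet_derivative ?G (at u)) (at u)"
      by (rule has_derivative_transform_within_open[OF _ op u])
         (use c in \<open>auto simp: deriv_along_chart[OF f c(1)] chart_inv_chart F_def\<close>)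
    then have "deriv_along A X (deriv_along A Y f) p = frechet_derivative ?G (at u) (X p)"
      using deriv_along_eqI by (simp add: c_def u_def)
    then show ?thesis using frechet_derivative_along_field[OF F op u V] by (simp add: Yp)
  qed
  have "linear (frechet_derivative F (at u))"
    by (rule linear_frechet_derivative[OF smooth_on_differentiable[OF F op u]])
  then show ?thesis
    unfolding second[OF X] second[OF Y]
    using second_derivative_symmetric[OF F op u, of "X p" "Y p"]
    by (simp add: deriv_along_def lie_bracket_def Let_def linear_diff c_def[symmetric] u_def[symmetric] F_def[symmetric])
qed

end

section \<open>Contractions and the Bochner tensor\<close>

lemma contract_add: "contract G (\<lambda>a b. S a b + T a b) = contract G S + contract G T"
  by (simp add: contract_def sum.distrib distrib_left)

lemma contract_cmult: "contract G (\<lambda>a b. k * S a b) = k * contract G S"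
  by (simp add: contract_def sum_distrib_left mult.left_commute)

lemma contract_diff: "contract G (\<lambda>a b. S a b - T a b) = contract G S - contract G T"
  by (simp add: contract_def sum_subtractf right_diff_distrib)

lemma bochner_add:
  "bochner n G P (\<lambda>x y z w. L x y z w + M x y z w) x y z w =
   bochner n G P L x y z w + bochner n G P M x y z w"
proof -
  have r: "ricci G (\<lambda>x y z w. L x y z w + M x y z w) = (\<lambda>y z. ricci G L y z + ricci G M y z)"
    by (simp add: ricci_def contract_add fun_eq_iff)
  have s: "scal G (\<lambda>x y z w. L x y z w + M x y z w) = scal G L + scal G M"
    by (simp add: scal_def r contract_add)
  have t: "scal_star G P (\<lambda>x y z w. L x y z w + M x y z w) = scal_star G P L + scal_star G P M"
    by (simp add: scal_star_def ricci_star_def[abs_def] contract_add)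
  have p: "psi1 G (\<lambda>y z. S y z + T y z) x y z w = psi1 G S x y z w + psi1 G T x y z w" for S T x y z w
    by (simp add: psi1_def algebra_simps)
  show ?thesis unfolding bochner_def r s t psi2_def p
    by (simp add: algebra_simps)
qed

text \<open>
  An inner product on \<open>'e\<close>, in general not the built-in one: the metric at a point.
\<close>

locale inner_form =
  fixes G :: "'e::euclidean_space \<Rightarrow> 'e \<Rightarrow> real"
  assumes G_bilinear: "bilinear G" and G_sym: "G u v = G v u" and G_pos: "u \<noteq> 0 \<Longrightarrow> G u u > 0"
begin

lemmas G_simps =
  bilinear_ladd[OF G_bilinear] bilinear_radd[OF G_bilinear]
  bilinear_lmul[OF G_bilinear] bilinear_rmul[OF G_bilinear]
  bilinear_lsub[OF G_bilinear] bilinear_rsub[OF G_bilinear]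
  bilinear_lneg[OF G_bilinear] bilinear_rneg[OF G_bilinear]
  bilinear_lzero[OF G_bilinear] bilinear_rzero[OF G_bilinear]

lemma G_linear: "linear (G u)" "linear (\<lambda>v. G v u)"
  using G_bilinear by (auto simp: bilinear_def)

lemma G_eq_imp_eq:
  assumes "\<And>w. G u w = G v w" shows "u = v"
proof (rule ccontr)
  assume "u \<noteq> v"
  then have "G (u - v) (u - v) > 0" by (intro G_pos) simp
  then show False using assms[of "u - v"] by (simp add: G_simps)
qed

lemma inverse_metric:
  assumes "i \<in> Basis" "k \<in> Basis"
  shows "(\<Sum>j\<in>Basis. inverse_metric G i j * G j k) = (if i = k then 1 else 0)"
proof -
  \<comment> \<open>\<open>f\<close> represents \<open>G\<close> by the built-in inner product; its inverse provides the rows of the inverse matrix.\<close>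
  define f where "f y = (\<Sum>k\<in>Basis. G y k *\<^sub>R k)" for y
  have f_inner: "f y \<bullet> x = G y x" for x y
  proof -
    have "G y x = G y (\<Sum>k\<in>Basis. (x \<bullet> k) *\<^sub>R k)" by (simp add: euclidean_representation)
    also have "\<dots> = (\<Sum>k\<in>Basis. (x \<bullet> k) * G y k)"
      by (simp add: linear_sum[OF G_linear(1)] linear_scale[OF G_linear(1)])
    also have "\<dots> = f y \<bullet> x" by (simp add: f_def inner_sum_left inner_commute[of x] mult.commute)
    finally show ?thesis by simp
  qed
  have lin: "linear f"
    by (rule linearI) (simp_all add: f_def G_simps scaleR_add_left sum.distrib scaleR_sum_right)
  have "inj f"
  proof (rule injI)
    fix u v assume "f u = f v"
    then have "G u w = G v w" for w by (simp flip: f_inner)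
    then show "u = v" by (rule G_eq_imp_eq)
  qed
  then have "surj f" using linear_injective_imp_surjective[OF lin] by simp
  then obtain H where H: "\<And>i. f (H i) = i" by (metis surjD)
  have "(\<Sum>j\<in>Basis. (H i \<bullet> j) * G j k) = (if i = k then 1 else 0)" if "i \<in> Basis" "k \<in> Basis" for i k
  proof -
    have "(\<Sum>j\<in>Basis. (H i \<bullet> j) * G j k) = G (\<Sum>j\<in>Basis. (H i \<bullet> j) *\<^sub>R j) k"
      by (simp add: linear_sum[OF G_linear(2)] linear_scale[OF G_linear(2)])
    also have "\<dots> = i \<bullet> k" by (simp add: euclidean_representation H flip: f_inner)
    finally show ?thesis using that by (simp add: inner_Basis)
  qed
  then have "\<exists>h. \<forall>i\<in>Basis. \<forall>k\<in>Basis. (\<Sum>j\<in>Basis. h i j * G j k) = (if i = k then 1 else 0)"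
    by (intro exI[of _ "\<lambda>i j. H i \<bullet> j"]) auto
  from someI_ex[OF this] assms show ?thesis unfolding inverse_metric_def by blast
qed

lemma inverse_metric_apply:
  assumes "i \<in> Basis" shows "(\<Sum>j\<in>Basis. inverse_metric G i j * G j y) = y \<bullet> i"
proof -
  have "(\<Sum>j\<in>Basis. inverse_metric G i j * G j y)
      = (\<Sum>j\<in>Basis. \<Sum>k\<in>Basis. (y \<bullet> k) * (inverse_metric G i j * G j k))"
    by (subst (1) euclidean_representation[of y, symmetric])
       (simp add: linear_sum[OF G_linear(1)] linear_scale[OF G_linear(1)] sum_distrib_left mult_ac)
  also have "\<dots> = (\<Sum>k\<in>Basis. (y \<bullet> k) * (\<Sum>j\<in>Basis. inverse_metric G i j * G j k))"
    by (subst sum.swap) (simp add: sum_distrib_left)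
  also have "\<dots> = (\<Sum>k\<in>Basis. if k = i then y \<bullet> i else 0)"
    using assms by (intro sum.cong) (auto simp: inverse_metric)
  also have "\<dots> = y \<bullet> i" using assms by simp
  finally show ?thesis .
qed

lemma inverse_metric_sym:
  assumes "i \<in> Basis" "j \<in> Basis" shows "inverse_metric G i j = inverse_metric G j i"
proof -
  have *: "inverse_metric G i j = (\<Sum>k\<in>Basis. \<Sum>l\<in>Basis. inverse_metric G i k * inverse_metric G j l * G l k)"
    if "i \<in> Basis" "j \<in> Basis" for i j
  proof -
    have "(\<Sum>k\<in>Basis. \<Sum>l\<in>Basis. inverse_metric G i k * inverse_metric G j l * G l k)
        = (\<Sum>k\<in>Basis. inverse_metric G i k * (k \<bullet> j))"
      using that by (intro sum.cong) (simp_all add: inverse_metric_apply mult.assoc flip: sum_distrib_left)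
    also have "\<dots> = (\<Sum>k\<in>Basis. if k = j then inverse_metric G i j else 0)"
      using that by (intro sum.cong) (auto simp: inner_Basis)
    finally show ?thesis using that by simp
  qed
  show ?thesis
    by (subst *[OF assms], subst *[OF assms(2,1)], subst sum.swap) (simp add: mult_ac G_sym[of _ "_::'e"])
qed

lemma contract_swap: "contract G (\<lambda>a b. S b a) = contract G S"
  unfolding contract_def by (subst sum.swap) (auto intro!: sum.cong simp: inverse_metric_sym)

text \<open>
  Contraction against \<open>G\<close> substitutes a vector; \<open>\<alpha>\<close> is only required to be linear in the
  contracted argument.
\<close>

lemma contract_metric_right:
  assumes "linear \<alpha>" shows "contract G (\<lambda>a b. \<alpha> a * G b y) = \<alpha> y"
proof -
  have "contract G (\<lambda>a b. \<alpha> a * G b y) = (\<Sum>i\<in>Basis. \<alpha> i * (\<Sum>j\<in>Basis. inverse_metric G i j * G j y))"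
    by (simp add: contract_def sum_distrib_left mult.left_commute)
  also have "\<dots> = (\<Sum>i\<in>Basis. \<alpha> i * (y \<bullet> i))" by (simp add: inverse_metric_apply)
  also have "\<dots> = \<alpha> (\<Sum>i\<in>Basis. (y \<bullet> i) *\<^sub>R i)"
    by (simp add: linear_sum[OF assms] linear_scale[OF assms] mult.commute)
  finally show ?thesis by (simp add: euclidean_representation)
qed

lemma contract_metric_left: "linear \<alpha> \<Longrightarrow> contract G (\<lambda>a b. G a y * \<alpha> b) = \<alpha> y"
  using contract_metric_right[of \<alpha> y] contract_swap[of "\<lambda>a b. \<alpha> a * G b y"] by (simp add: mult.commute)

lemma contract_endo: "contract G (\<lambda>a b. G a (f b)) = endo_trace f"
proof -
  have "contract G (\<lambda>a b. G b (f a)) = (\<Sum>i\<in>Basis. f i \<bullet> i)"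
    by (simp add: contract_def inverse_metric_apply)
  then show ?thesis using contract_swap[of "\<lambda>a b. G b (f a)"] by (simp add: endo_trace_def)
qed

lemma contract_metric: "contract G G = real DIM('e)"
  using contract_endo[of "\<lambda>x. x"] by (simp add: endo_trace_def)

end

text \<open>
  The tangent space at a point of a Riemannian almost product manifold with traceless \<open>P\<close>.
\<close>

locale almost_product_space = inner_form G for G :: "'e::euclidean_space \<Rightarrow> 'e \<Rightarrow> real" +
  fixes P :: "'e \<Rightarrow> 'e" and n :: nat
  assumes P_linear: "linear P" and P_P: "P (P x) = x" and G_P_P: "G (P x) (P y) = G x y"
    and trace_P: "endo_trace P = 0" and dim: "DIM('e) = 2 * n"
begin

lemmas P_simps = linear_add[OF P_linear] linear_scale[OF P_linear] linear_diff[OF P_linear]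
  linear_neg[OF P_linear] linear_0[OF P_linear]

lemma G_P_left: "G (P x) y = G x (P y)"
  using G_P_P[of x "P y"] by (simp add: P_P)

text \<open>
  The Bochner tensor annihilates \<open>(\<psi>\<^sub>1 + \<psi>\<^sub>2)(S)\<close>. With \<open>t\<close> and \<open>u\<close> the traces of \<open>S\<close> and of \<open>S(\<cdot>,P\<cdot>)\<close>,
  its Ricci tensor is \<open>t g + u g(\<cdot>,P\<cdot>) + 2(n - 2) S\<close>, so the Ricci term of the Bochner tensor
  equals the tensor itself up to multiples of \<open>\<pi>\<^sub>1 + \<pi>\<^sub>2\<close> and \<open>\<pi>\<^sub>3\<close>, which the scalar terms remove.
\<close>

lemma bochner_psi:
  assumes S_bil: "bilinear S" and S_sym: "\<And>x y. S x y = S y x" and S_P: "\<And>x y. S (P x) (P y) = S x y"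
    and n: "n \<ge> 3"
  shows "bochner n G P (\<lambda>x y z w. psi1 G S x y z w + psi2 G P S x y z w) x y z w = 0"
proof -
  let ?M = "\<lambda>x y z w. psi1 G S x y z w + psi2 G P S x y z w"
  let ?t = "contract G S" and ?u = "contract G (\<lambda>a b. S a (P b))"
  have S_lin: "linear (S a)" "linear (\<lambda>x. S x a)" for a using S_bil by (auto simp: bilinear_def)
  have S_P_lin: "linear (\<lambda>b. S a (P b))" for a
    using linear_compose[OF P_linear S_lin(1)] by (simp add: o_def)
  have S_P_left: "S (P x) y = S x (P y)" for x y using S_P[of x "P y"] by (simp add: P_P)
  have S_P_sym: "S x (P y) = S y (P x)" for x y using S_sym[of x "P y"] by (simp add: S_P_left)
  have G_P_sym: "G x (P y) = G y (P x)" for x y using G_sym[of x "P y"] by (simp add: G_P_left)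
  have cP: "contract G (\<lambda>a b. G a (P b)) = 0" by (simp add: contract_endo trace_P)
  have c1: "contract G (\<lambda>a b. G a v * S y b) = S y v" for v y
    by (rule contract_metric_left[OF S_lin(1)])
  have c2: "contract G (\<lambda>a b. S a v * G y b) = S y v" for v y
    using contract_metric_right[OF S_lin(2)[of v], of y] by (simp add: G_sym[of y])
  have c3: "contract G (\<lambda>a b. G a v * S y (P b)) = S y (P v)" for v y
    by (rule contract_metric_left[OF S_P_lin])
  have c4: "contract G (\<lambda>a b. S a v * G y (P b)) = S (P y) v" for v y
    using contract_metric_right[OF S_lin(2)[of v], of "P y"] by (simp add: G_sym[of _ "P y"] G_P_left)
  have ric: "ricci G ?M y z = G y z * ?t + G y (P z) * ?u + (2 * real n - 4) * S y z" for y z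
    unfolding ricci_def psi1_def psi2_def
    by (simp add: contract_add contract_diff contract_cmult c1 c2 c3 c4 cP contract_metric dim P_P S_P)
       (simp add: algebra_simps)
  have ric_star: "ricci_star G P ?M y z = G y z * ?u + G y (P z) * ?t + (2 * real n - 4) * S y (P z)" for y z
    unfolding ricci_star_def psi1_def psi2_def
    by (simp add: contract_add contract_diff contract_cmult c1 c2 c3 c4 cP contract_metric dim P_P
          S_P_left)
       (simp add: algebra_simps)
  have sc: "scal G ?M = (4 * real n - 4) * ?t"
  proof -
    have "scal G ?M = contract G (\<lambda>y z. ?t * G y z + ?u * G y (P z) + (2 * real n - 4) * S y z)"
      by (simp add: scal_def ric[abs_def] mult.commute)
    then show ?thesis
      unfolding contract_add contract_cmult cP contract_metric dim by (simp add: algebra_simps)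
  qed
  have sc_star: "scal_star G P ?M = (4 * real n - 4) * ?u"
  proof -
    have "scal_star G P ?M = contract G (\<lambda>y z. ?u * G y z + ?t * G y (P z) + (2 * real n - 4) * S y (P z))"
      by (simp add: scal_star_def ric_star[abs_def] mult.commute)
    then show ?thesis
      unfolding contract_add contract_cmult cP contract_metric dim by (simp add: algebra_simps)
  qed
  have psi_ric: "psi1 G (ricci G ?M) x y z w + psi2 G P (ricci G ?M) x y z w =
      2 * ?t * (pi1 G x y z w + pi2 G P x y z w) + 2 * ?u * pi3 G P x y z w + (2 * real n - 4) * ?M x y z w"
    unfolding ric[abs_def] by (simp add: psi1_def psi2_def pi1_def pi2_def pi3_def P_P algebra_simps)
  have ne: "real n - 2 \<noteq> 0" "real n - 1 \<noteq> 0" using n by auto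
  have "1 / (2 * (real n - 1)) * (scal G ?M * (pi1 G x y z w + pi2 G P x y z w) + scal_star G P ?M * pi3 G P x y z w)
    = 2 * ?t * (pi1 G x y z w + pi2 G P x y z w) + 2 * ?u * pi3 G P x y z w"
    unfolding sc sc_star using ne by (simp add: divide_simps) (simp add: algebra_simps)
  then have "bochner n G P ?M x y z w = ?M x y z w - 1 / (2 * (real n - 2)) * ((2 * real n - 4) * ?M x y z w)"
    unfolding bochner_def psi_ric by simp
  also have "\<dots> = 0" using ne by (simp add: divide_simps)
  finally show ?thesis .
qed

text \<open>
  The algebraic heart of the argument. \<open>\<Phi>\<close> is the difference of the curvature tensors of a natural
  connection and of the Levi-Civita connection, \<open>\<theta>\<close> the associated form with dual vector \<open>Om\<close>, and \<open>S\<close>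
  its covariant derivative. Terms with a product such as \<open>\<theta>(x) \<theta>(w)\<close> come from \<open>q\<close> and from \<open>Q\<close>;
  they cancel after averaging over \<open>(z, w)\<close> and \<open>(P z, P w)\<close>. What remains contains \<open>\<theta>\<close> only through
  \<open>S\<close> and \<open>\<theta> Om\<close>, the square of its norm.
\<close>

lemma average_curvature_difference:
  fixes c d \<epsilon> :: real and S :: "'e \<Rightarrow> 'e \<Rightarrow> real" and Om :: 'e and \<theta> :: "'e \<Rightarrow> real"
  defines "h \<equiv> \<lambda>x y. c * G x y + d * G x (P y)"
  defines "J \<equiv> \<lambda>x. c *\<^sub>R x + d *\<^sub>R P x"
  defines "Q \<equiv> \<lambda>x y. h x y *\<^sub>R Om - \<theta> y *\<^sub>R J x"
  defines "q \<equiv> \<lambda>x y z. h x y * \<theta> z - \<theta> y * h x z"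
  defines "\<Phi> \<equiv> \<lambda>x y z w.
     h y z * S x w - h y w * S x z - h x z * S y w + h x w * S y z
     + q (\<theta> x *\<^sub>R J y - \<theta> y *\<^sub>R J x) z w + G (Q y z) (Q x w) - G (Q x z) (Q y w)"
  defines "S' \<equiv> \<lambda>x y. (c - \<epsilon> * d) / 2 * S x y
     + \<theta> Om * ((c\<^sup>2 + d\<^sup>2) / 4 * G x y + c * d / 2 * G x (P y))"
  assumes \<epsilon>: "\<epsilon> = 1 \<or> \<epsilon> = -1"
    and \<theta>: "\<And>x. \<theta> x = G Om x" and \<theta>_P: "\<And>x. \<theta> (P x) = - \<epsilon> * \<theta> x"
    and S_P: "\<And>x y. S x (P y) = - \<epsilon> * S x y"
  shows "(\<Phi> x y z w + \<Phi> x y (P z) (P w)) / 2 = psi1 G S' x y z w + psi2 G P S' x y z w"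
proof -
  have GJ: "G (J x) y = h x y" for x y by (simp add: J_def h_def G_simps G_P_left)
  have G_P_sym: "G x (P y) = G y (P x)" for x y using G_sym[of x "P y"] by (simp add: G_P_left)
  have h_sym: "h x y = h y x" for x y by (simp add: h_def G_sym[of x y] G_P_sym[of x y])
  have Q: "G (Q x y) v = h x y * \<theta> v - \<theta> y * h x v" for x y v
    by (simp add: Q_def G_simps GJ \<theta>)
  have \<theta>_lin: "\<theta> (a *\<^sub>R u + b *\<^sub>R v) = a * \<theta> u + b * \<theta> v" "\<theta> (a *\<^sub>R u - b *\<^sub>R v) = a * \<theta> u - b * \<theta> v"
    for a b u v by (simp_all add: \<theta> G_simps)
  have \<theta>_J: "\<theta> (J x) = (c - \<epsilon> * d) * \<theta> x" for x
    by (simp add: J_def \<theta>_lin \<theta>_P algebra_simps)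
  have h_J: "h x (J y) = (c\<^sup>2 + d\<^sup>2) * G x y + 2 * c * d * G x (P y)" for x y
    by (simp add: h_def J_def G_simps P_simps P_P power2_eq_square algebra_simps)
  have h_Om: "h x Om = (c - \<epsilon> * d) * \<theta> x" for x
    using \<theta>_J[of x] by (simp add: h_sym[of x] GJ[symmetric] \<theta> G_sym[of Om]) 
  have QQ: "G (Q y z) (Q x w) = h y z * (h x w * \<theta> Om - (c - \<epsilon> * d) * \<theta> w * \<theta> x)
      - \<theta> z * (h x w * (c - \<epsilon> * d) * \<theta> y - \<theta> w * ((c\<^sup>2 + d\<^sup>2) * G x y + 2 * c * d * G x (P y)))" for x y z w
  proof -
    have "\<theta> (Q x w) = h x w * \<theta> Om - (c - \<epsilon> * d) * \<theta> w * \<theta> x"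
      by (simp add: Q_def \<theta>_lin \<theta>_J)
    moreover have "h y (Q x w) = G (Q x w) (J y)" by (simp add: GJ[symmetric] G_sym)
    ultimately show ?thesis
      unfolding Q by (simp add: \<theta>_J h_J)
  qed
  have qT: "q (\<theta> x *\<^sub>R J y - \<theta> y *\<^sub>R J x) z w =
     (\<theta> x * ((c\<^sup>2 + d\<^sup>2) * G y z + 2 * c * d * G y (P z)) - \<theta> y * ((c\<^sup>2 + d\<^sup>2) * G x z + 2 * c * d * G x (P z))) * \<theta> w
     - \<theta> z * (\<theta> x * ((c\<^sup>2 + d\<^sup>2) * G y w + 2 * c * d * G y (P w)) - \<theta> y * ((c\<^sup>2 + d\<^sup>2) * G x w + 2 * c * d * G x (P w)))"
    for x y z w
  proof -
    have "h (\<theta> x *\<^sub>R J y - \<theta> y *\<^sub>R J x) v = \<theta> x * h v (J y) - \<theta> y * h v (J x)" for v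
      by (subst h_sym) (simp add: h_def G_simps P_simps algebra_simps)
    moreover have "h v (J y) = (c\<^sup>2 + d\<^sup>2) * G y v + 2 * c * d * G y (P v)" for v y
      by (simp only: h_J G_sym[of v y] G_P_sym[of v y])
    ultimately show ?thesis by (simp only: q_def)
  qed
  have sym: "G y x = G x y" "G y (P x) = G x (P y)" by (rule G_sym, rule G_P_sym)
  from \<epsilon> show ?thesis
  proof
    assume e: "\<epsilon> = 1"
    show ?thesis unfolding \<Phi>_def QQ qT psi1_def psi2_def S'_def h_def S_P \<theta>_P P_P e
      by (simp add: sym field_simps power2_eq_square)
  next
    assume e: "\<epsilon> = -1"
    show ?thesis unfolding \<Phi>_def QQ qT psi1_def psi2_def S'_def h_def S_P \<theta>_P P_P e
      by (simp add: sym field_simps power2_eq_square)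
  qed
qed

end

section \<open>The curvature of a linear connection\<close>

context smooth_manifold
begin

lemma linear_connectionD:
  assumes "linear_connection A D"
  shows "vector_field A X \<Longrightarrow> vector_field A Y \<Longrightarrow> vector_field A (D X Y)"
    and "vector_field A X \<Longrightarrow> vector_field A Y \<Longrightarrow> vector_field A Z \<Longrightarrow>
      D X (\<lambda>p. Y p + Z p) = (\<lambda>p. D X Y p + D X Z p)"
    and "smooth_fun A f \<Longrightarrow> vector_field A X \<Longrightarrow> vector_field A Y \<Longrightarrow>
      D X (\<lambda>p. f p *\<^sub>R Y p) = (\<lambda>p. deriv_along A X f p *\<^sub>R Y p + f p *\<^sub>R D X Y p)"
  using assms unfolding linear_connection_def by blast+

lemma vector_field_diff: "vector_field A X \<Longrightarrow> vector_field A Y \<Longrightarrow> vector_field A (\<lambda>p. X p - Y p)"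
  using vector_field_add[of X, OF _ vector_field_cmult[of Y "-1"]] by simp

text \<open>
  The value of the curvature at \<open>p\<close> depends on its third argument only through its value at \<open>p\<close>; the
  derivatives of a factor \<open>f\<close> cancel because \<open>[X,Y] f = X (Y f) - Y (X f)\<close>.
\<close>

lemma curvature_tensorial:
  assumes D: "linear_connection A D" and X: "vector_field A X" and Y: "vector_field A Y"
    and B: "vector_field A (lie_bracket A X Y)"
    and Z: "vector_field A Z" "vector_field A Z'" "Z p = Z' p"
  shows "curvature A D X Y Z p = curvature A D X Y Z' p"
proof (rule tensorial_cong[where T = "\<lambda>Z. curvature A D X Y Z p", OF _ _ Z])
  note F = linear_connectionD(1)[OF D] and add = linear_connectionD(2)[OF D]
  fix Y' Z assume vf: "vector_field A Y'" "vector_field A Z"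
  show "curvature A D X Y (\<lambda>q. Y' q + Z q) p = curvature A D X Y Y' p + curvature A D X Y Z p"
    using vf X Y B by (simp add: curvature_def add F)
next
  note F = linear_connectionD(1)[OF D] and add = linear_connectionD(2)[OF D] and scale = linear_connectionD(3)[OF D]
  fix f Z assume f: "smooth_fun A f" and Z: "vector_field A Z"
  have 2: "D X (D Y (\<lambda>q. f q *\<^sub>R Z q)) p = deriv_along A X (deriv_along A Y f) p *\<^sub>R Z p
      + deriv_along A Y f p *\<^sub>R D X Z p + (deriv_along A X f p *\<^sub>R D Y Z p + f p *\<^sub>R D X (D Y Z) p)"
    if "vector_field A X" "vector_field A Y" for X Y
    using that f Z by (simp add: scale add F vector_field_scaleR smooth_fun_deriv_along)
  show "curvature A D X Y (\<lambda>q. f q *\<^sub>R Z q) p = f p *\<^sub>R curvature A D X Y Z p"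
    unfolding curvature_def 2[OF X Y] 2[OF Y X] scale[OF f B Z] lie_bracket_deriv[OF f X Y]
    by (simp add: algebra_simps)
qed

end

section \<open>Natural connections on manifolds of the two classes\<close>

text \<open>
  The geometric situation, with \<open>\<epsilon> = 1\<close> for the class \<open>W3\<close> and \<open>\<epsilon> = -1\<close> for the class \<open>W6\<close>. \<open>D\<close> is the
  Levi-Civita connection, \<open>D'\<close> the natural connection with parameters \<open>l\<close> and \<open>m\<close>, and \<open>Om\<close> the
  vector field dual to the form \<open>\<theta>\<close>, of which only the values are used.
\<close>

locale natural_connection_of_class = smooth_manifold A
  for A :: "('m::{t2_space,second_countable_topology}, 'e::euclidean_space) chart set" +
  fixes P :: "'m \<Rightarrow> 'e \<Rightarrow> 'e" and g :: "'m \<Rightarrow> 'e \<Rightarrow> 'e \<Rightarrow> real" and D D' :: "('m, 'e) connection"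
    and n :: nat and \<epsilon> l m :: real and \<theta> :: "'m \<Rightarrow> 'e \<Rightarrow> real" and Om :: "'m \<Rightarrow> 'e"
  assumes metric: "riemannian_metric A g" and P_tensor: "tensor_field_11 A P"
    and PP: "P p (P p x) = x" and gPP: "g p (P p x) (P p y) = g p x y"
    and traceP: "endo_trace (P p) = 0" and dim: "DIM('e) = 2 * n" and n_ge: "n \<ge> 3"
    and LC: "levi_civita A g D"
    and conn': "linear_connection A D'" and endo': "endo_parallel A D' P" and metric': "metric_parallel A D' g"
    and eps: "\<epsilon> = 1 \<or> \<epsilon> = -1"
    and theta: "\<theta> p x = g p (Om p) x"
    and theta_P: "\<theta> p (P p x) = - \<epsilon> * \<theta> p x"
    and F: "vector_field A X \<Longrightarrow> vector_field A Y \<Longrightarrow> vector_field A Z \<Longrightarrow>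
      F_tensor D P g X Y Z p = 1 / (2 * real n) *
        ((g p (X p) (Y p) + \<epsilon> * g p (X p) (P p (Y p))) * \<theta> p (Z p)
         + (g p (X p) (Z p) + \<epsilon> * g p (X p) (P p (Z p))) * \<theta> p (Y p))"
    and theta_closed: "closed_1form A \<theta>"
    and tor: "vector_field A X \<Longrightarrow> vector_field A Y \<Longrightarrow> vector_field A Z \<Longrightarrow>
      g p (torsion A D' X Y p) (Z p) =
           1 / (2 * real n) * (g p (Y p) (Z p) * \<theta> p (P p (X p)) - g p (X p) (Z p) * \<theta> p (P p (Y p)))
           + l * (g p (Y p) (Z p) * \<theta> p (X p) - g p (X p) (Z p) * \<theta> p (Y p)
              + g p (Y p) (P p (Z p)) * \<theta> p (P p (X p)) - g p (X p) (P p (Z p)) * \<theta> p (P p (Y p)))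
           + m * (g p (Y p) (P p (Z p)) * \<theta> p (X p) - g p (X p) (P p (Z p)) * \<theta> p (Y p)
              + g p (Y p) (Z p) * \<theta> p (P p (X p)) - g p (X p) (Z p) * \<theta> p (P p (Y p)))"
begin

lemma almost_product_space: "almost_product_space (g p) (P p) n"
proof unfold_locales
  show "bilinear (g p)" using metric unfolding riemannian_metric_def by blast
  show "g p u v = g p v u" for u v using metric unfolding riemannian_metric_def by blast
  show "0 < g p u u" if "u \<noteq> 0" for u using metric that unfolding riemannian_metric_def by blast
  have "linear (P p)" using P_tensor unfolding tensor_field_11_def by blast
  then show "P p (x + y) = P p x + P p y" "P p (k *\<^sub>R x) = k *\<^sub>R P p x" for x y k
    by (simp_all add: linear_add linear_scale)
qed (simp_all add: PP gPP traceP dim)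

sublocale tangent: almost_product_space "g p" "P p" n for p
  by (rule almost_product_space)

lemma smooth_g: "vector_field A X \<Longrightarrow> vector_field A Y \<Longrightarrow> smooth_fun A (\<lambda>p. g p (X p) (Y p))"
  using metric unfolding riemannian_metric_def by blast

lemma P_field: "vector_field A X \<Longrightarrow> vector_field A (\<lambda>p. P p (X p))"
  using P_tensor unfolding tensor_field_11_def by blast

lemma conn: "linear_connection A D"
  using LC unfolding levi_civita_def by blast

lemmas D_field = linear_connectionD(1)[OF conn] and D'_field = linear_connectionD(1)[OF conn']

lemma theta_simps:
  "\<theta> p (x + y) = \<theta> p x + \<theta> p y" "\<theta> p (x - y) = \<theta> p x - \<theta> p y" "\<theta> p (k *\<^sub>R x) = k * \<theta> p x"
  by (simp_all add: theta tangent.G_simps)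

lemma lie_bracket_eq:
  assumes "vector_field A X" "vector_field A Y"
  shows "lie_bracket A X Y = (\<lambda>p. D X Y p - D Y X p)"
proof
  fix p
  have "torsion A D X Y p = 0" using LC assms unfolding levi_civita_def by blast
  then show "lie_bracket A X Y p = D X Y p - D Y X p" by (simp add: torsion_def)
qed

lemma vector_field_lie_bracket:
  "vector_field A X \<Longrightarrow> vector_field A Y \<Longrightarrow> vector_field A (lie_bracket A X Y)"
  by (simp add: lie_bracket_eq vector_field_diff D_field)

lemma metric_deriv:
  assumes "vector_field A X" "vector_field A Y" "vector_field A Z"
  shows "deriv_along A X (\<lambda>q. g q (Y q) (Z q)) p = g p (D X Y p) (Z p) + g p (Y p) (D X Z p)"
    and "deriv_along A X (\<lambda>q. g q (Y q) (Z q)) p = g p (D' X Y p) (Z p) + g p (Y p) (D' X Z p)"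
proof -
  have "cov_deriv_metric A D g X Y Z p = 0"
    using LC assms unfolding levi_civita_def metric_parallel_def by blast
  then show "deriv_along A X (\<lambda>q. g q (Y q) (Z q)) p = g p (D X Y p) (Z p) + g p (Y p) (D X Z p)"
    by (simp add: cov_deriv_metric_def)
  have "cov_deriv_metric A D' g X Y Z p = 0"
    using metric' assms unfolding metric_parallel_def by blast
  then show "deriv_along A X (\<lambda>q. g q (Y q) (Z q)) p = g p (D' X Y p) (Z p) + g p (Y p) (D' X Z p)"
    by (simp add: cov_deriv_metric_def)
qed

lemma D'_P:
  assumes "vector_field A X" "vector_field A Y"
  shows "D' X (\<lambda>q. P q (Y q)) = (\<lambda>q. P q (D' X Y q))"
proof
  fix p
  have "cov_deriv_endo D' P X Y p = 0" using endo' assms unfolding endo_parallel_def by blast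
  then show "D' X (\<lambda>q. P q (Y q)) p = P p (D' X Y p)" by (simp add: cov_deriv_endo_def)
qed

text \<open>
  Since \<open>P\<close> is traceless, both eigenvalues \<open>1\<close> and \<open>-1\<close> occur.
\<close>

lemma exists_eigenvector: "\<exists>v. P p v = \<epsilon> *\<^sub>R v \<and> v \<noteq> 0"
proof (rule ccontr)
  assume no: "\<not> ?thesis"
  have "P p x = (- \<epsilon>) *\<^sub>R x" for x
  proof -
    have "P p (x + \<epsilon> *\<^sub>R P p x) = \<epsilon> *\<^sub>R (x + \<epsilon> *\<^sub>R P p x)"
      using eps by (auto simp: tangent.P_simps PP)
    with no have "x + \<epsilon> *\<^sub>R P p x = 0" by blast
    with eps show ?thesis by (elim disjE) (simp_all add: add_eq_0_iff)
  qed
  then have "endo_trace (P p) = - \<epsilon> * (2 * real n)"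
    using dim by (simp add: endo_trace_def)
  with traceP[of p] eps n_ge show False by auto
qed

text \<open>
  The form \<open>\<theta>\<close> is defined pointwise by a trace, so its differentiability is not immediate. For a field
  \<open>V\<close> with \<open>P V = \<epsilon> V\<close> one has \<open>\<theta>(V) = 0\<close> and \<open>n F(V,V,W) = g(V,V) \<theta>(W)\<close>, and \<open>V\<close> can be chosen
  nonzero near the given point.
\<close>

lemma theta_differentiable:
  assumes W: "vector_field A W"
  shows "differentiable_fun_at (\<lambda>q. \<theta> q (W q)) p"
proof -
  obtain v where v: "P p v = \<epsilon> *\<^sub>R v" "v \<noteq> 0" using exists_eigenvector by blast
  define U where "U = extend A p v"
  have U: "vector_field A U" "U p = v" by (simp_all add: U_def extend)
  \<comment> \<open>An eigenfield of \<open>P\<close> on the whole manifold with \<open>V p = 2 v\<close>.\<close>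
  define V where "V q = U q + \<epsilon> *\<^sub>R P q (U q)" for q
  have V: "vector_field A V"
    unfolding V_def[abs_def] by (intro vector_field_add vector_field_cmult P_field U)
  have PV: "P q (V q) = \<epsilon> *\<^sub>R V q" for q
    using eps by (auto simp: V_def tangent.P_simps PP)
  have "V p = 2 *\<^sub>R v" using eps by (auto simp: V_def U v scaleR_2)
  then have Vp: "V p \<noteq> 0" using v by simp
  have thV: "\<theta> q (V q) = 0" for q
  proof -
    have "\<epsilon> * \<theta> q (V q) = - \<epsilon> * \<theta> q (V q)" using theta_P[of q "V q"] by (simp add: PV theta_simps)
    then show ?thesis using eps by auto
  qed
  define a where "a q = g q (V q) (V q)" for q
  define b where "b q = real n * F_tensor D P g V V W q" for q
  have b: "b q = a q * \<theta> q (W q)" for q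
    using F[OF V V W] eps n_ge by (auto simp: b_def a_def PV thV tangent.G_simps)
  have sa: "smooth_fun A a" unfolding a_def[abs_def] by (intro smooth_g V)
  have "vector_field A (cov_deriv_endo D P V V)"
    unfolding cov_deriv_endo_def[abs_def] by (intro vector_field_diff D_field P_field V)
  then have "smooth_fun A (F_tensor D P g V V W)"
    unfolding F_tensor_def[abs_def] by (intro smooth_g W)
  then have sb: "smooth_fun A b"
    unfolding b_def[abs_def] by (intro smooth_fun_mult smooth_fun_const)
  define k where "k = chart_at A p"
  have k: "k \<in> A" "p \<in> fst k" using chart_at by (auto simp: k_def)
  let ?a = "a \<circ> chart_inv k" and ?b = "b \<circ> chart_inv k"
  have cont: "continuous_on (chart_image k) ?a"
    using sa k by (intro smooth_on_continuous) (auto simp: smooth_fun_def)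
  have op: "open (chart_image k \<inter> ?a -` (- {0}))"
    by (rule continuous_open_preimage[OF cont chart_homeo(2)[OF k(1)]]) auto
  have "g p (V p) (V p) > 0" by (rule tangent.G_pos[OF Vp])
  then have ap: "?a (snd k p) \<noteq> 0" using k by (simp add: a_def chart_inv_chart)
  have "(\<lambda>u. ?b u / ?a u) differentiable (at (snd k p))"
    by (intro differentiable_divide smooth_fun_differentiable sa sb k ap)
  then obtain f' where "((\<lambda>u. ?b u / ?a u) has_derivative f') (at (snd k p))"
    by (auto simp: differentiable_def)
  then have "(((\<lambda>q. \<theta> q (W q)) \<circ> chart_inv k) has_derivative f') (at (snd k p))"
    by (rule has_derivative_transform_within_open[OF _ op]) (use k ap in \<open>auto simp: b\<close>)
  then show ?thesis unfolding differentiable_fun_at_def k_def differentiable_def by blast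
qed

section \<open>The difference of the two connections\<close>

text \<open>
  As \<open>\<theta> \<circ> P = -\<epsilon> \<theta>\<close>, the torsion of \<open>D'\<close> depends on \<open>l\<close> and \<open>m\<close> only through \<open>c\<close> and \<open>d\<close>: it is
  \<open>T(x,y) = \<theta>(x) J y - \<theta>(y) J x\<close> with \<open>J = c I + d P\<close>. The symmetric form \<open>h\<close> is \<open>g(J \<cdot>, \<cdot>)\<close>, the tensor \<open>Q\<close>
  will be \<open>D' - D\<close>, and \<open>q\<close> is \<open>Q\<close> with its values lowered by \<open>g\<close>.
\<close>

definition c :: real where "c = l - \<epsilon> * (1 / (2 * real n) + m)"
definition d :: real where "d = m - \<epsilon> * l"
definition h :: "'m \<Rightarrow> 'e \<Rightarrow> 'e \<Rightarrow> real" where "h p x y = c * g p x y + d * g p x (P p y)"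
definition J :: "'m \<Rightarrow> 'e \<Rightarrow> 'e" where "J p x = c *\<^sub>R x + d *\<^sub>R P p x"
definition Q :: "'m \<Rightarrow> 'e \<Rightarrow> 'e \<Rightarrow> 'e" where "Q p x y = h p x y *\<^sub>R Om p - \<theta> p y *\<^sub>R J p x"
definition q :: "'m \<Rightarrow> 'e \<Rightarrow> 'e \<Rightarrow> 'e \<Rightarrow> real" where "q p x y z = h p x y * \<theta> p z - \<theta> p y * h p x z"

lemma G_P_sym: "g p x (P p y) = g p y (P p x)"
  using tangent.G_sym[of p x "P p y"] by (simp add: tangent.G_P_left)

lemma h_sym: "h p x y = h p y x"
  by (simp add: h_def tangent.G_sym[of p x y] G_P_sym[of p x y])

lemma q_diff_left:
  "q p (x - y) z w = q p x z w - q p y z w"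
  by (simp add: q_def h_def tangent.G_simps algebra_simps)

lemma g_J: "g p (J p x) y = h p x y"
  by (simp add: J_def h_def tangent.G_simps tangent.G_P_left)

lemma g_Q: "g p (Q p x y) z = q p x y z"
  by (simp add: Q_def q_def tangent.G_simps g_J theta)

lemma torsion_eq:
  assumes "vector_field A X" "vector_field A Y"
  shows "torsion A D' X Y p = \<theta> p (X p) *\<^sub>R J p (Y p) - \<theta> p (Y p) *\<^sub>R J p (X p)"
proof (rule tangent.G_eq_imp_eq)
  fix z
  show "g p (torsion A D' X Y p) z = g p (\<theta> p (X p) *\<^sub>R J p (Y p) - \<theta> p (Y p) *\<^sub>R J p (X p)) z"
    using tor[OF assms extend(1)[of p z], of p]
    by (simp add: extend theta_P tangent.G_simps g_J h_def c_def d_def algebra_simps)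
qed

text \<open>
  Both connections are metric, so \<open>D' - D\<close> is skew in its last two arguments and therefore
  determined by the torsion of \<open>D'\<close>.
\<close>

lemma D'_minus_D:
  assumes X: "vector_field A X" and Y: "vector_field A Y"
  shows "D' X Y p - D X Y p = Q p (X p) (Y p)"
proof (rule tangent.G_eq_imp_eq)
  fix z
  define Z where "Z = extend A p z"
  have Z: "vector_field A Z" "Z p = z" by (simp_all add: Z_def extend)
  define k where "k X Y Z = g p (D' X Y p - D X Y p) (Z p)" for X Y Z
  have skew: "k X Y Z = - k X Z Y" if "vector_field A X" "vector_field A Y" "vector_field A Z" for X Y Z
    using metric_deriv[OF that, of p]
    by (simp add: k_def tangent.G_simps tangent.G_sym[of p "Y p"])
  have tors: "k X Y Z - k Y X Z = \<theta> p (X p) * h p (Y p) (Z p) - \<theta> p (Y p) * h p (X p) (Z p)"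
    if "vector_field A X" "vector_field A Y" for X Y Z
  proof -
    have "torsion A D' X Y p = (D' X Y p - D X Y p) - (D' Y X p - D Y X p)"
      using that by (simp add: torsion_def lie_bracket_eq)
    then have "k X Y Z - k Y X Z = g p (torsion A D' X Y p) (Z p)"
      by (simp add: k_def tangent.G_simps)
    then show ?thesis using that by (simp add: torsion_eq tangent.G_simps g_J)
  qed
  \<comment> \<open>\<open>2 k(X,Y,Z) = T(X,Y,Z) - T(Y,Z,X) + T(Z,X,Y)\<close>, as for the Koszul formula.\<close>
  have "k X Y Z = q p (X p) (Y p) (Z p)"
    using skew[OF X Y Z(1)] skew[OF Y X Z(1)] skew[OF Z(1) X Y] tors[OF X Y, of Z] tors[OF Y Z(1), of X]
      tors[OF Z(1) X, of Y] h_sym[of p "X p" "Y p"] h_sym[of p "X p" "Z p"] h_sym[of p "Y p" "Z p"]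
    by (simp add: q_def algebra_simps)
  then show "g p (D' X Y p - D X Y p) z = g p (Q p (X p) (Y p)) z"
    by (simp add: k_def Z g_Q)
qed

lemma g_D:
  assumes "vector_field A X" "vector_field A Y"
  shows "g p (D X Y p) z = g p (D' X Y p) z - q p (X p) (Y p) z"
  by (simp flip: D'_minus_D[OF assms] g_Q add: tangent.G_simps)

section \<open>The covariant derivative of the associated form\<close>

text \<open>
  \<open>(D'\<^sub>X \<theta>) Y\<close>, the covariant derivative of \<open>\<theta>\<close> with respect to the natural connection.
\<close>

definition cov_theta :: "('m \<Rightarrow> 'e) \<Rightarrow> ('m \<Rightarrow> 'e) \<Rightarrow> 'm \<Rightarrow> real" where
  "cov_theta X Y p = deriv_along A X (\<lambda>q. \<theta> q (Y q)) p - \<theta> p (D' X Y p)"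

text \<open>
  Closedness of \<open>\<theta>\<close> gives the symmetry, because \<open>\<theta>\<close> vanishes on the values of the torsion.
\<close>

lemma cov_theta_sym:
  assumes X: "vector_field A X" and Y: "vector_field A Y"
  shows "cov_theta X Y p = cov_theta Y X p"
proof -
  have "deriv_along A X (\<lambda>q. \<theta> q (Y q)) p - deriv_along A Y (\<lambda>q. \<theta> q (X q)) p
      - \<theta> p (lie_bracket A X Y p) = 0"
    using theta_closed X Y unfolding closed_1form_def by blast
  moreover have "\<theta> p (lie_bracket A X Y p) = \<theta> p (D' X Y p) - \<theta> p (D' Y X p) - \<theta> p (torsion A D' X Y p)"
    by (simp add: torsion_def theta_simps)
  moreover have "\<theta> p (torsion A D' X Y p) = 0"
    using X Y by (simp add: torsion_eq J_def theta_simps theta_P algebra_simps)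
  ultimately show ?thesis by (simp add: cov_theta_def)
qed

lemma cov_theta_P:
  assumes X: "vector_field A X" and Y: "vector_field A Y"
  shows "cov_theta X (\<lambda>q. P q (Y q)) p = - \<epsilon> * cov_theta X Y p"
  using deriv_along_cmult(1)[OF theta_differentiable[OF Y], where k = "- \<epsilon>"]
  by (simp add: cov_theta_def D'_P[OF X Y] theta_P algebra_simps)

lemma cov_theta_add:
  assumes X: "vector_field A X" and Y: "vector_field A Y" "vector_field A Z"
  shows "cov_theta X (\<lambda>q. Y q + Z q) p = cov_theta X Y p + cov_theta X Z p"
  using deriv_along_add(1)[OF theta_differentiable[OF Y(1)] theta_differentiable[OF Y(2)]]
  by (simp add: cov_theta_def linear_connectionD(2)[OF conn' X Y] theta_simps)

lemma cov_theta_scaleR: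
  assumes X: "vector_field A X" and f: "smooth_fun A f" and Y: "vector_field A Y"
  shows "cov_theta X (\<lambda>q. f q *\<^sub>R Y q) p = f p *\<^sub>R cov_theta X Y p"
  using deriv_along_mult(1)[OF smooth_fun_imp_differentiable_fun_at[OF f] theta_differentiable[OF Y]]
  by (simp add: cov_theta_def linear_connectionD(3)[OF conn' f X Y] theta_simps algebra_simps)

lemma cov_theta_cong:
  assumes "vector_field A X" "vector_field A Y" "vector_field A Z" "Y p = Z p"
  shows "cov_theta X Y p = cov_theta X Z p"
  by (rule tensorial_cong[where T = "\<lambda>Y. cov_theta X Y p", OF _ _ assms(2-4)])
     (simp_all add: cov_theta_add cov_theta_scaleR assms(1))

text \<open>
  The same tensor on tangent vectors at \<open>p\<close>; by \<open>cov_theta_cong\<close> and the symmetry the extensions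
  are immaterial.
\<close>

definition cov_theta_at :: "'m \<Rightarrow> 'e \<Rightarrow> 'e \<Rightarrow> real" where
  "cov_theta_at p x y = cov_theta (extend A p x) (extend A p y) p"

lemma cov_theta_at_sym: "cov_theta_at p x y = cov_theta_at p y x"
  by (simp add: cov_theta_at_def cov_theta_sym extend)

lemma cov_theta_at_P: "cov_theta_at p x (P p y) = - \<epsilon> * cov_theta_at p x y"
  using cov_theta_cong[of "extend A p x" "extend A p (P p y)" "\<lambda>q. P q (extend A p y q)" p]
  by (simp add: cov_theta_at_def cov_theta_P extend P_field)

lemma cov_theta_at_bilinear: "bilinear (cov_theta_at p)"
proof -
  have add: "cov_theta_at p x (y + z) = cov_theta_at p x y + cov_theta_at p x z" for x y z
    using cov_theta_cong[of "extend A p x" "extend A p (y + z)" "\<lambda>q. extend A p y q + extend A p z q" p]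
    by (simp add: cov_theta_at_def cov_theta_add extend vector_field_add)
  have scale: "cov_theta_at p x (k *\<^sub>R y) = k * cov_theta_at p x y" for x y k
    using cov_theta_cong[of "extend A p x" "extend A p (k *\<^sub>R y)" "\<lambda>q. k *\<^sub>R extend A p y q" p]
    by (simp add: cov_theta_at_def cov_theta_scaleR[OF extend(1) smooth_fun_const extend(1)] extend vector_field_cmult)
  have 1: "linear (cov_theta_at p x)" for x by (rule linearI) (simp_all add: add scale)
  have "(\<lambda>x. cov_theta_at p x y) = cov_theta_at p y" for y by (rule ext) (rule cov_theta_at_sym)
  with 1 show ?thesis by (simp add: bilinear_def)
qed

section \<open>Comparison of the curvature tensors\<close>

lemma deriv_h:
  assumes "vector_field A X" "vector_field A Y" "vector_field A Z"
  shows "deriv_along A X (\<lambda>r. h r (Y r) (Z r)) p = h p (D' X Y p) (Z p) + h p (Y p) (D' X Z p)"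
    and "differentiable_fun_at (\<lambda>r. h r (Y r) (Z r)) p"
proof -
  note s = smooth_fun_imp_differentiable_fun_at[OF smooth_g[OF assms(2,3)]]
    smooth_fun_imp_differentiable_fun_at[OF smooth_g[OF assms(2) P_field[OF assms(3)]]]
  note k = deriv_along_cmult[OF s(1), where k = c] deriv_along_cmult[OF s(2), where k = d]
  show "deriv_along A X (\<lambda>r. h r (Y r) (Z r)) p = h p (D' X Y p) (Z p) + h p (Y p) (D' X Z p)"
    unfolding h_def using deriv_along_add(1)[OF k(2,4), of X]
    by (simp add: k(1,3) metric_deriv(2) assms P_field D'_P algebra_simps)
  show "differentiable_fun_at (\<lambda>r. h r (Y r) (Z r)) p"
    unfolding h_def by (rule deriv_along_add(2)[OF k(2,4)])
qed

lemma deriv_q: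
  assumes X: "vector_field A X" and Y: "vector_field A Y" and Z: "vector_field A Z" and W: "vector_field A W"
  shows "deriv_along A X (\<lambda>r. q r (Y r) (Z r) (W r)) p =
      h p (Y p) (Z p) * cov_theta X W p - cov_theta X Z p * h p (Y p) (W p)
      + q p (D' X Y p) (Z p) (W p) + q p (Y p) (D' X Z p) (W p) + q p (Y p) (Z p) (D' X W p)"
    and "differentiable_fun_at (\<lambda>r. q r (Y r) (Z r) (W r)) p"
proof -
  note h = deriv_h[OF X Y]
  note m1 = deriv_along_mult[OF h(2)[OF Z] theta_differentiable[OF W]]
  note m2 = deriv_along_mult[OF theta_differentiable[OF Z] h(2)[OF W]]
  note m2' = deriv_along_cmult[OF m2(2), where k = "-1"]
  have eq: "(\<lambda>r. q r (Y r) (Z r) (W r)) =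
      (\<lambda>r. h r (Y r) (Z r) * \<theta> r (W r) + (-1) * (\<theta> r (Z r) * h r (Y r) (W r)))"
    by (simp add: q_def)
  have th: "deriv_along A X (\<lambda>q. \<theta> q (W q)) p = cov_theta X W p + \<theta> p (D' X W p)"
    "deriv_along A X (\<lambda>q. \<theta> q (Z q)) p = cov_theta X Z p + \<theta> p (D' X Z p)"
    by (simp_all add: cov_theta_def)
  show "deriv_along A X (\<lambda>r. q r (Y r) (Z r) (W r)) p =
      h p (Y p) (Z p) * cov_theta X W p - cov_theta X Z p * h p (Y p) (W p)
      + q p (D' X Y p) (Z p) (W p) + q p (Y p) (D' X Z p) (W p) + q p (Y p) (Z p) (D' X W p)"
    unfolding eq deriv_along_add(1)[OF m1(2) m2'(2)] m2'(1) m1(1) m2(1) h(1)[OF Z] h(1)[OF W] th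
    by (simp add: q_def algebra_simps)
  show "differentiable_fun_at (\<lambda>r. q r (Y r) (Z r) (W r)) p"
    unfolding eq by (rule deriv_along_add(2)[OF m1(2) m2'(2)])
qed

text \<open>
  Both connections being metric, only derivatives of functions have to be compared: those of
  \<open>g(D\<^sub>Y Z, W)\<close> and \<open>g(D'\<^sub>Y Z, W)\<close>, which differ by \<open>q(Y,Z,W)\<close>. No derivative of \<open>Om\<close> appears.
\<close>

lemma second_derivative_difference:
  assumes X: "vector_field A X" and Y: "vector_field A Y" and Z: "vector_field A Z" and W: "vector_field A W"
  shows "g p (D X (D Y Z) p) (W p) = g p (D' X (D' Y Z) p) (W p)
     - (h p (Y p) (Z p) * cov_theta X W p - cov_theta X Z p * h p (Y p) (W p)) - q p (D' X Y p) (Z p) (W p)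
     + q p (Y p) (W p) (D' X Z p) + q p (X p) (W p) (D' Y Z p)
     - g p (Q p (Y p) (Z p)) (Q p (X p) (W p))"
proof -
  have fields: "vector_field A (D Y Z)" "vector_field A (D' Y Z)" using Y Z by (auto intro: D_field D'_field)
  have "(\<lambda>r. g r (D' Y Z r) (W r)) = (\<lambda>r. g r (D Y Z r) (W r) + q r (Y r) (Z r) (W r))"
    by (simp add: g_D[OF Y Z])
  then have "deriv_along A X (\<lambda>r. g r (D' Y Z r) (W r)) p =
      deriv_along A X (\<lambda>r. g r (D Y Z r) (W r)) p + deriv_along A X (\<lambda>r. q r (Y r) (Z r) (W r)) p"
    using deriv_along_add(1)[OF smooth_fun_imp_differentiable_fun_at[OF smooth_g[OF fields(1) W]] deriv_q(2)[OF X Y Z W]]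
    by simp
  then have "g p (D' X (D' Y Z) p) (W p) + g p (D' Y Z p) (D' X W p) =
      g p (D X (D Y Z) p) (W p) + g p (D Y Z p) (D X W p) + deriv_along A X (\<lambda>r. q r (Y r) (Z r) (W r)) p"
    by (simp add: metric_deriv(1)[OF X fields(1) W] metric_deriv(2)[OF X fields(2) W])
  moreover have "g p (D Y Z p) (D X W p) = g p (D' Y Z p) (D' X W p) - q p (Y p) (Z p) (D' X W p)
      - q p (X p) (W p) (D' Y Z p) + g p (Q p (Y p) (Z p)) (Q p (X p) (W p))"
  proof -
    have "D Y Z p = D' Y Z p - Q p (Y p) (Z p)" "D X W p = D' X W p - Q p (X p) (W p)"
      using D'_minus_D[OF Y Z, of p] D'_minus_D[OF X W, of p] by (simp_all add: algebra_simps)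
    then show ?thesis
      by (simp add: tangent.G_simps g_Q tangent.G_sym[of p "D' Y Z p" "Q p (X p) (W p)"])
  qed
  moreover have "q p (Y p) (D' X Z p) (W p) = - q p (Y p) (W p) (D' X Z p)" by (simp add: q_def)
  ultimately show ?thesis unfolding deriv_q(1)[OF X Y Z W] by linarith
qed

text \<open>
  Exchanging \<open>X\<close> and \<open>Y\<close> and subtracting removes the values of \<open>q\<close> at \<open>D' X Z\<close> and \<open>D' Y Z\<close>; those at
  \<open>D' X Y\<close>, \<open>D' Y X\<close> and \<open>[X,Y]\<close> combine to the torsion.
\<close>

lemma curvature_difference:
  assumes X: "vector_field A X" and Y: "vector_field A Y" and Z: "vector_field A Z" and W: "vector_field A W"
  shows "g p (curvature A D X Y Z p) (W p) = g p (curvature A D' X Y Z p) (W p)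
     - (h p (Y p) (Z p) * cov_theta X W p - h p (Y p) (W p) * cov_theta X Z p
        - h p (X p) (Z p) * cov_theta Y W p + h p (X p) (W p) * cov_theta Y Z p
        + q p (\<theta> p (X p) *\<^sub>R J p (Y p) - \<theta> p (Y p) *\<^sub>R J p (X p)) (Z p) (W p)
        + g p (Q p (Y p) (Z p)) (Q p (X p) (W p)) - g p (Q p (X p) (Z p)) (Q p (Y p) (W p)))"
proof -
  let ?B = "lie_bracket A X Y"
  have "g p (D ?B Z p) (W p) = g p (D' ?B Z p) (W p) - q p (?B p) (Z p) (W p)"
    by (rule g_D[OF vector_field_lie_bracket[OF X Y] Z])
  moreover have "q p (\<theta> p (X p) *\<^sub>R J p (Y p) - \<theta> p (Y p) *\<^sub>R J p (X p)) (Z p) (W p) =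
      q p (D' X Y p) (Z p) (W p) - q p (D' Y X p) (Z p) (W p) - q p (?B p) (Z p) (W p)"
    unfolding torsion_eq[OF X Y, symmetric] torsion_def q_diff_left by simp
  ultimately show ?thesis
    unfolding curvature_def tangent.G_simps
      second_derivative_difference[OF X Y Z W] second_derivative_difference[OF Y X Z W]
    by (simp add: algebra_simps)
qed

lemma curvature'_P:
  assumes X: "vector_field A X" and Y: "vector_field A Y" and Z: "vector_field A Z"
  shows "curvature A D' X Y (\<lambda>q. P q (Z q)) p = P p (curvature A D' X Y Z p)"
  by (simp add: curvature_def D'_P D'_field vector_field_lie_bracket X Y Z tangent.P_simps)

text \<open>
  The left-hand side uses the chosen extension of \<open>P z\<close>, not \<open>P\<close> applied to that of \<open>z\<close>.
\<close>

lemma curvature_tensor'_P: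
  "curvature_tensor A g D' p x y (P p z) (P p w) = curvature_tensor A g D' p x y z w"
proof -
  let ?X = "extend A p x" and ?Y = "extend A p y" and ?Z = "extend A p z"
  have "curvature A D' ?X ?Y (extend A p (P p z)) p = curvature A D' ?X ?Y (\<lambda>q. P q (?Z q)) p"
    by (rule curvature_tensorial[OF conn'])
       (simp_all add: extend P_field vector_field_lie_bracket)
  then show ?thesis by (simp add: curvature_tensor_def curvature'_P extend gPP)
qed

text \<open>
  The symmetric, \<open>P\<close>-invariant form for which \<open>R' - K = (\<psi>\<^sub>1 + \<psi>\<^sub>2)(psi_source p)\<close>.
\<close>

definition psi_source :: "'m \<Rightarrow> 'e \<Rightarrow> 'e \<Rightarrow> real" where
  "psi_source p x y = (c - \<epsilon> * d) / 2 * cov_theta_at p x y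
     + \<theta> p (Om p) * ((c\<^sup>2 + d\<^sup>2) / 4 * g p x y + c * d / 2 * g p x (P p y))"

lemma curvature'_eq:
  "curvature_tensor A g D' p x y z w =
    K_tensor A P g D p x y z w + (psi1 (g p) (psi_source p) x y z w + psi2 (g p) (P p) (psi_source p) x y z w)"
proof -
  define \<Phi> where "\<Phi> x y z w =
     h p y z * cov_theta_at p x w - h p y w * cov_theta_at p x z - h p x z * cov_theta_at p y w + h p x w * cov_theta_at p y z
     + q p (\<theta> p x *\<^sub>R J p y - \<theta> p y *\<^sub>R J p x) z w + g p (Q p y z) (Q p x w) - g p (Q p x z) (Q p y w)"
    for x y z w
  have R: "curvature_tensor A g D p x y z w = curvature_tensor A g D' p x y z w - \<Phi> x y z w" for z w
    using curvature_difference[OF extend(1)[of p x] extend(1)[of p y] extend(1)[of p z] extend(1)[of p w], of p]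
    by (simp add: curvature_tensor_def extend \<Phi>_def cov_theta_at_def)
  have "(\<Phi> x y z w + \<Phi> x y (P p z) (P p w)) / 2 = psi1 (g p) (psi_source p) x y z w + psi2 (g p) (P p) (psi_source p) x y z w"
    using tangent.average_curvature_difference[where p = p and \<epsilon> = \<epsilon> and \<theta> = "\<theta> p" and Om = "Om p" and S = "cov_theta_at p"
        and c = c and d = d, OF eps theta theta_P cov_theta_at_P]
    unfolding \<Phi>_def q_def[abs_def] Q_def[abs_def] J_def[abs_def] h_def[abs_def] psi_source_def[abs_def] by simp
  then show ?thesis
    by (simp add: K_tensor_def R curvature_tensor'_P field_simps)
qed

lemma bochner_eq:
  "bochner n (g p) (P p) (curvature_tensor A g D' p) = bochner n (g p) (P p) (K_tensor A P g D p)"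
proof (intro ext)
  fix x y z w
  have bil: "bilinear (psi_source p)"
  proof -
    have *: "psi_source p = (\<lambda>x y. (c - \<epsilon> * d) / 2 * cov_theta_at p x y
     + \<theta> p (Om p) * ((c\<^sup>2 + d\<^sup>2) / 4 * g p x y + c * d / 2 * g p x (P p y)))" by (simp add: psi_source_def fun_eq_iff)
    note bil = bilinear_ladd[OF cov_theta_at_bilinear] bilinear_radd[OF cov_theta_at_bilinear]
      bilinear_lmul[OF cov_theta_at_bilinear] bilinear_rmul[OF cov_theta_at_bilinear]
    show ?thesis unfolding bilinear_def *
      by (intro conjI allI linearI) (simp_all add: bil tangent.G_simps tangent.P_simps field_simps)
  qed
  have sym: "psi_source p x y = psi_source p y x" for x y
    by (simp add: psi_source_def cov_theta_at_sym[of p x y] tangent.G_sym[of p x y] G_P_sym[of p x y])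
  have cov_theta_at_PP: "cov_theta_at p (P p x) (P p y) = cov_theta_at p x y" for x y
    using eps cov_theta_at_sym[of p x y] by (auto simp: cov_theta_at_P cov_theta_at_sym[of p "P p x"])
  have SP: "psi_source p (P p x) (P p y) = psi_source p x y" for x y
    by (simp add: psi_source_def cov_theta_at_PP gPP)
  have "curvature_tensor A g D' p = (\<lambda>x y z w. K_tensor A P g D p x y z w
      + (psi1 (g p) (psi_source p) x y z w + psi2 (g p) (P p) (psi_source p) x y z w))"
    by (intro ext curvature'_eq)
  then have "bochner n (g p) (P p) (curvature_tensor A g D' p) x y z w =
      bochner n (g p) (P p) (K_tensor A P g D p) x y z w
      + bochner n (g p) (P p) (\<lambda>x y z w. psi1 (g p) (psi_source p) x y z w + psi2 (g p) (P p) (psi_source p) x y z w) x y z w"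
    using bochner_add[of n "g p" "P p" "K_tensor A P g D p"] by simp
  then show "bochner n (g p) (P p) (curvature_tensor A g D' p) x y z w =
      bochner n (g p) (P p) (K_tensor A P g D p) x y z w"
    by (simp only: tangent.bochner_psi[OF bil sym SP n_ge] add_0_right)
qed

end

section \<open>The invariance of the Bochner tensor\<close>

theorem theorem3p1:
  fixes A :: "('m::{t2_space,second_countable_topology}, 'e::euclidean_space) chart set"
    and P :: "'m \<Rightarrow> 'e \<Rightarrow> 'e"
    and g :: "'m \<Rightarrow> 'e \<Rightarrow> 'e \<Rightarrow> real"
    and nabla nabla' :: "('m, 'e) connection"
    and n :: nat
  assumes "riemannian_almost_product_manifold A P g"
    and "\<And>p. endo_trace (P p) = 0"
    and "DIM('e) = 2 * n" and "2 * n \<ge> 6"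
    and "levi_civita A g nabla"
    and "class_W3 n A P g nabla \<or> class_W6 n A P g nabla"
    and "closed_1form A (theta_form A P g nabla)"
    and "natural_connection n A P g nabla nabla'"
  shows "bochner n (g p) (P p) (curvature_tensor A g nabla' p)
       = bochner n (g p) (P p) (K_tensor A P g nabla p)"
proof -
  define \<theta> where "\<theta> = theta_form A P g nabla"
  have atlas: "smooth_atlas A" and metric: "riemannian_metric A g" and P: "tensor_field_11 A P"
    and PP: "\<And>p x. P p (P p x) = x" and gPP: "\<And>p x y. g p (P p x) (P p y) = g p x y"
    using assms(1) unfolding riemannian_almost_product_manifold_def by blast+
  interpret smooth_manifold A by unfold_locales (rule atlas)
  \<comment> \<open>The vector dual to the form, read off from the trace that defines it.\<close>
  define Om where "Om p = (\<Sum>i\<in>Basis. \<Sum>j\<in>Basis. inverse_metric (g p) i j *\<^sub>R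
      cov_deriv_endo nabla P (extend A p i) (extend A p j) p)" for p
  have theta: "\<theta> p x = g p (Om p) x" for p x
  proof -
    have lin: "linear (\<lambda>v. g p v x)"
      using metric unfolding riemannian_metric_def bilinear_def by blast
    show ?thesis
      by (simp add: \<theta>_def theta_form_def contract_def F_tensor_def extend Om_def
          linear_sum[OF lin] linear_scale[OF lin])
  qed
  obtain \<epsilon> where eps: "\<epsilon> = 1 \<or> \<epsilon> = (-1::real)"
    and F: "\<And>X Y Z p. vector_field A X \<Longrightarrow> vector_field A Y \<Longrightarrow> vector_field A Z \<Longrightarrow>
      F_tensor nabla P g X Y Z p = 1 / (2 * real n) *
        ((g p (X p) (Y p) + \<epsilon> * g p (X p) (P p (Y p))) * \<theta> p (Z p)
         + (g p (X p) (Z p) + \<epsilon> * g p (X p) (P p (Z p))) * \<theta> p (Y p))"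
    and theta_P: "\<And>p x. \<theta> p (P p x) = - \<epsilon> * \<theta> p x"
    using assms(6)
  proof
    assume "class_W3 n A P g nabla"
    then show thesis by (intro that[of 1]) (simp_all add: class_W3_def Let_def \<theta>_def)
  next
    assume "class_W6 n A P g nabla"
    then show thesis by (intro that[of "-1"]) (simp_all add: class_W6_def Let_def \<theta>_def)
  qed
  obtain l m where tor: "\<And>X Y Z p. vector_field A X \<Longrightarrow> vector_field A Y \<Longrightarrow> vector_field A Z \<Longrightarrow>
      g p (torsion A nabla' X Y p) (Z p) =
           1 / (2 * real n) * (g p (Y p) (Z p) * \<theta> p (P p (X p)) - g p (X p) (Z p) * \<theta> p (P p (Y p)))
           + l * (g p (Y p) (Z p) * \<theta> p (X p) - g p (X p) (Z p) * \<theta> p (Y p)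
              + g p (Y p) (P p (Z p)) * \<theta> p (P p (X p)) - g p (X p) (P p (Z p)) * \<theta> p (P p (Y p)))
           + m * (g p (Y p) (P p (Z p)) * \<theta> p (X p) - g p (X p) (P p (Z p)) * \<theta> p (Y p)
              + g p (Y p) (Z p) * \<theta> p (P p (X p)) - g p (X p) (Z p) * \<theta> p (P p (Y p)))"
    using assms(8) unfolding natural_connection_def Let_def \<theta>_def by blast
  interpret natural_connection_of_class A P g nabla nabla' n \<epsilon> l m \<theta> Om
    using assms metric P PP gPP eps theta theta_P F tor
    by unfold_locales (auto simp: natural_connection_def \<theta>_def)
  show ?thesis by (rule bochner_eq)
qed

end
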